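(* For infinitely many integers $k$, there exists a simple regular graph $G$ satisfying \[\mathrm{bp}(G) = k \quad\text{and}\quad \chi(G) \geq k^{\widetilde{\Omega}(\log k)}.\] That is, there are absolute constants $a>0$ and $b\ge 0$ such that for infinitely many integers $k\ge 4$ there is a simple regular graph $G$ with $\mathrm{bp}(G)=k$ and $\chi(G) \ge k^{a\log_2 k/(\log_2\log_2 k)^b}$.
   Context: Graphs are finite and undirected; a graph is simple if it has no loops and no parallel edges, and regular if all its vertices have the same degree. $\chi(G)$ is the chromatic number of $G$. $\mathrm{bp}(G)$ is the biclique partition number of $G$: the smallest number of edge-disjoint bicliques (complete bipartite subgraphs of $G$, not necessarily induced) needed for a partition of the edge set of $G$. The notation $\widetilde{\Omega}(\log k)$ hides factors polynomial in $\log\log k$. *)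

theory Defs
  imports Complex_Main "Graph_Theory.Graph_Theory"
begin

text \<open>
  A finite simple graph is a \<^locale>\<open>pair_graph\<close>: an undirected edge \<open>{u, v}\<close> is the pair of
  opposite arcs \<open>(u, v)\<close>, \<open>(v, u)\<close>, so the out-degree of a vertex is its degree.
\<close>

definition regular_graph :: "'a pair_pre_digraph \<Rightarrow> bool" where
  "regular_graph G \<longleftrightarrow> (\<exists>d. \<forall>v \<in> pverts G. out_degree (with_proj G) v = d)"

definition proper_coloring :: "'a pair_pre_digraph \<Rightarrow> nat \<Rightarrow> ('a \<Rightarrow> nat) \<Rightarrow> bool" where
  "proper_coloring G n c \<longleftrightarrow>
     (\<forall>v \<in> pverts G. c v < n) \<and> (\<forall>(u, v) \<in> parcs G. c u \<noteq> c v)"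

definition chromatic_number :: "'a pair_pre_digraph \<Rightarrow> nat" where
  "chromatic_number G = (LEAST n. \<exists>c. proper_coloring G n c)"

definition biclique :: "'a pair_pre_digraph \<Rightarrow> bool" where
  "biclique H \<longleftrightarrow> (\<exists>m n. m > 0 \<and> n > 0 \<and> complete_bipartite_digraph m n (with_proj H))"

text \<open>
  The bicliques are subgraphs that need not be induced. Since their arc sets are symmetric,
  they are edge-disjoint exactly if their arc sets are disjoint.
\<close>

definition biclique_partition :: "'a pair_pre_digraph \<Rightarrow> 'a pair_pre_digraph set \<Rightarrow> bool" where
  "biclique_partition G P \<longleftrightarrow>
     finite P \<and>
     (\<forall>H \<in> P. subgraph (with_proj H) (with_proj G) \<and> biclique H) \<and>
     (\<forall>H \<in> P. \<forall>H' \<in> P. H \<noteq> H' \<longrightarrow> parcs H \<inter> parcs H' = {}) \<and>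
     (\<Union>H \<in> P. parcs H) = parcs G"

definition bp :: "'a pair_pre_digraph \<Rightarrow> nat" where
  "bp G = (LEAST k. \<exists>P. biclique_partition G P \<and> card P = k)"

text \<open>For finite simple graphs both minima are attained.\<close>

lemma chromatic_number_attained:
  assumes "pair_graph G"
  shows "\<exists>c. proper_coloring G (chromatic_number G) c"
proof -
  interpret pair_graph G by fact
  obtain c :: "'a \<Rightarrow> nat" and n where c: "c ` pverts G = {i. i < n}" "inj_on c (pverts G)"
    using finite_imp_inj_to_nat_seg[OF pair_finite_verts] by blast
  have "proper_coloring G n c"
    unfolding proper_coloring_def
  proof (intro conjI ballI, goal_cases)
    case (1 v)
    then show ?case using c(1) by blast
  next
    case (2 e)
    then show ?case
      using pair_no_loops[of e] arc_fst_in_verts[of e] arc_snd_in_verts[of e] c(2)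
      by (cases e) (simp add: inj_on_eq_iff)
  qed
  then show ?thesis
    unfolding chromatic_number_def
    using LeastI[where P = "\<lambda>n. \<exists>c. proper_coloring G n c"] by blast
qed

lemma bp_attained:
  assumes "pair_graph G"
  shows "\<exists>P. biclique_partition G P \<and> card P = bp G"
proof -
  interpret pair_graph G by fact
  define K where "K = (\<lambda>(u, v). \<lparr> pverts = {u, v}, parcs = {(u, v), (v, u)} \<rparr> :: 'a pair_pre_digraph)"
  have sym: "(v, u) \<in> parcs G" if "(u, v) \<in> parcs G" for u v
    using that pair_sym_arcs by (auto simp: symmetric_def dest: symD)
  have "biclique_partition G (K ` parcs G)"
    unfolding biclique_partition_def
  proof (intro conjI ballI impI, goal_cases)
    case 1
    then show ?case using pair_finite_arcs by simp
  next
    case (2 H)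
    then obtain u v where H: "(u, v) \<in> parcs G" "H = K (u, v)" by auto
    interpret H: pair_wf_digraph "K (u, v)"
      by unfold_locales (auto simp: K_def)
    show ?case
      using H sym[of u v] in_arcsD1[of u v] in_arcsD2[of u v] wf_digraph H.wf_digraph
      by (auto simp: subgraph_def compatible_def) (auto simp: K_def)
  next
    case (3 H)
    then obtain u v where H: "(u, v) \<in> parcs G" "H = K (u, v)" by auto
    have "u \<noteq> v" using pair_no_loops[OF H(1)] by simp
    have "pverts H = {u} \<union> {v} \<and> {u} \<inter> {v} = {} \<and> card {u} = 1 \<and> card {v} = 1 \<and>
        parcs H = {u} \<times> {v} \<union> {v} \<times> {u}"
      using \<open>u \<noteq> v\<close> by (auto simp: H(2) K_def)
    moreover have "finite (pverts H)" by (simp add: H(2) K_def)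
    ultimately have "complete_bipartite_digraph 1 1 (with_proj H)"
      unfolding complete_bipartite_digraph_pair_def
      by (intro conjI) (assumption, rule exI[of _ "{u}"], rule exI[of _ "{v}"], assumption)
    then show ?case
      unfolding biclique_def by (rule_tac exI[of _ 1], rule_tac exI[of _ 1]) simp
  next
    case (4 H H')
    then obtain u v x y where H: "H = K (u, v)" "H' = K (x, y)" by auto
    have "K (v, u) = K (u, v)" by (simp add: K_def insert_commute)
    then have "(x, y) \<noteq> (u, v)" "(x, y) \<noteq> (v, u)" using \<open>H \<noteq> H'\<close> H by auto
    then show ?case unfolding H by (auto simp: K_def)
  next
    case 5
    have "parcs (K e) \<subseteq> parcs G" "e \<in> parcs (K e)" if "e \<in> parcs G" for e
      using that sym[of "fst e" "snd e"] by (cases e; simp add: K_def)+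
    then show ?case by blast
  qed
  then show ?thesis
    unfolding bp_def
    using LeastI[where P = "\<lambda>k. \<exists>P. biclique_partition G P \<and> card P = k"] by blast
qed

end

(*
  A partial Boolean function with certificates of size O(p log p) is constructed on the p^2 points and
  p^2 lines of an affine plane of order p such that at the all-zero string no p^2/8 bits exclude either
  value. Cheat sheets turn it into a total function with unambiguous 1-certificates of size
  p polylog(p), while 0-certificates at the all-zero string have size at least p^2/8. Composition with
  an index gadget of size polynomial in p lifts both bounds to communication: the ones of the
  resulting matrix are partitioned into 2^(p polylog p) rectangles, but every zero rectangle contains
  only a 2^(-Omega(p^2)) fraction of the hard inputs. The hard inputs are the vertices of a graph in
  which two inputs (x, Y) and (x', Y') are adjacent if (x, Y') or (x', Y) is a 1-input. Its
  independent sets span zero rectangles and its bicliques are the 1-rectangles, so that it has a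
  small biclique partition number and a large chromatic number. Padding the bicliques makes it regular.
*)
theory Submission
  imports Defs "HOL-Library.FuncSet" "HOL-Number_Theory.Cong"
begin

section \<open>Index gadgets\<close>

text \<open>The separation is quadratic in the exponent: log bp is at most p up to polylogarithmic
  factors, log chi at least of order p^2. Constant-factor losses in these exponents are therefore
  affordable. One such loss is forced: an edge may be covered twice, through (x, Y') and through
  (x', Y), so the rectangles do not yet partition the edges. The repair squares the number of
  bicliques and takes a square root of the chromatic bound. Cheat sheets enter because only
  unambiguous certificates give disjoint rectangles. The zero string is used because a hard input,
  paired with itself, then satisfies no certificate, so there are no loops. Only an upper bound on
  bp is ever proved. The integer k is whatever bp of the graph turns out to be; it is unbounded
  since chi is at most 2 to the power bp.\<close>

lemma two_power_fact_le: "(2::real) ^ n * fact n \<le> fact (2 * n)"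
proof (induction n)
  case (Suc n)
  have "(2::real) ^ Suc n * fact (Suc n) = (2 * (real n + 1)) * (2 ^ n * fact n)"
    by simp
  also have "\<dots> \<le> (2 * (real n + 1)) * fact (2 * n)"
    using Suc by (intro mult_left_mono) auto
  also have "\<dots> \<le> (2 * (real n + 1)) * ((2 * real n + 1) * fact (2 * n))"
    by (intro mult_left_mono) (auto simp: algebra_simps)
  also have "\<dots> = fact (2 * Suc n)"
    by (simp add: algebra_simps)
  finally show ?case .
qed simp

text \<open>The Taylor series of cosh x and exp (x^2 / 2) are compared term by term; the zeros
  interleaved into the second series align it with the vanishing odd terms of the first.\<close>

lemma exp_plus_exp_minus_le:
  fixes x :: real
  shows "exp x + exp (- x) \<le> 2 * exp (x\<^sup>2 / 2)"
proof -
  define g :: "nat \<Rightarrow> real" where "g = (\<lambda>n. (x\<^sup>2 / 2) ^ n /\<^sub>R fact n)"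
  have exp_sums: "(\<lambda>n. if even n then g (n div 2) else 0) sums (0 + exp (x\<^sup>2 / 2))"
    using sums_if[OF sums_zero exp_converges[of "x\<^sup>2 / 2"]] unfolding g_def by simp
  have "(if even n then x ^ n /\<^sub>R fact n else 0) \<le> (if even n then g (n div 2) else 0)" for n
  proof (cases "even n")
    case True
    then obtain k where k: "n = 2 * k" by blast
    have "(x\<^sup>2) ^ k / fact (2 * k) \<le> (x\<^sup>2) ^ k / (2 ^ k * fact k)"
      using two_power_fact_le[of k] by (intro divide_left_mono) auto
    then show ?thesis
      by (simp add: k g_def power_mult divide_simps mult.commute[of "fact k"])
  qed simp
  then have "cosh x \<le> 0 + exp (x\<^sup>2 / 2)"
    by (rule sums_le[OF _ cosh_converges exp_sums])
  then show ?thesis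
    by (simp add: cosh_def)
qed

text \<open>Chernoff's method: a uniformly random \<open>c\<close> gives independent signs, so the
  exponential moment factors over \<open>M\<close>.\<close>

lemma hoeffding_subsets:
  fixes v :: "'a \<Rightarrow> real"
  assumes "finite M" and "t \<ge> 0" and "\<sigma> > 0" and \<sigma>: "(\<Sum>a\<in>M. (v a)\<^sup>2) \<le> \<sigma>"
  shows "card {c \<in> Pow M. t \<le> (\<Sum>a\<in>M. if a \<in> c then v a else - v a)} \<le> 2 ^ card M * exp (- t\<^sup>2 / (2 * \<sigma>))"
    (is "real (card ?B) \<le> _")
proof -
  \<comment> \<open>The minimiser of \<open>s\<^sup>2 * \<sigma> / 2 - s * t\<close>, the exponent
    of the moment bound.\<close>
  define s where "s = t / \<sigma>"
  have "s \<ge> 0" using assms by (simp add: s_def)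
  let ?X = "\<lambda>c. \<Sum>a\<in>M. if a \<in> c then v a else - v a"
  have "card ?B * exp (s * t) \<le> (\<Sum>c\<in>?B. exp (s * ?X c))"
    using \<open>s \<ge> 0\<close> by (intro sum_bounded_below[where K = "exp (s * t)", simplified]) (auto intro: mult_left_mono)
  also have "\<dots> \<le> (\<Sum>c\<in>Pow M. exp (s * ?X c))"
    using \<open>finite M\<close> by (intro sum_mono2) auto
  also have "\<dots> = (\<Sum>c\<in>Pow M. (\<Prod>a\<in>c. exp (s * v a)) * (\<Prod>a\<in>M - c. exp (- (s * v a))))"
  proof (rule sum.cong[OF refl])
    fix c assume c: "c \<in> Pow M"
    have "finite c" using c \<open>finite M\<close> by (auto intro: finite_subset)
    have "?X c = (\<Sum>a\<in>c. v a) + (\<Sum>a\<in>M - c. - v a)"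
      using c \<open>finite M\<close> by (simp add: sum.If_cases Int_absorb1 Diff_eq)
    then show "exp (s * ?X c) = (\<Prod>a\<in>c. exp (s * v a)) * (\<Prod>a\<in>M - c. exp (- (s * v a)))"
      using \<open>finite M\<close> \<open>finite c\<close>
      by (simp add: distrib_left exp_add sum_distrib_left exp_sum)
  qed
  also have "\<dots> = (\<Prod>a\<in>M. exp (s * v a) + exp (- (s * v a)))"
    using \<open>finite M\<close> by (rule prod_add[symmetric])
  also have "\<dots> \<le> (\<Prod>a\<in>M. 2 * exp ((s * v a)\<^sup>2 / 2))"
    by (intro prod_mono conjI add_nonneg_nonneg exp_plus_exp_minus_le) auto
  also have "\<dots> = 2 ^ card M * exp (s\<^sup>2 * (\<Sum>a\<in>M. (v a)\<^sup>2) / 2)"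
    using \<open>finite M\<close>
    by (simp add: prod.distrib exp_sum[symmetric] sum_distrib_left sum_divide_distrib power_mult_distrib)
  also have "\<dots> \<le> 2 ^ card M * exp (s\<^sup>2 * \<sigma> / 2)"
    using \<sigma> by (auto intro!: mult_left_mono)
  finally have "card ?B \<le> 2 ^ card M * (exp (s\<^sup>2 * \<sigma> / 2) * exp (- (s * t)))"
    by (simp add: exp_minus field_simps)
  moreover have "s\<^sup>2 * \<sigma> / 2 + - (s * t) = - t\<^sup>2 / (2 * \<sigma>)"
    using \<open>\<sigma> > 0\<close> by (simp add: s_def field_simps power2_eq_square)
  ultimately show ?thesis
    by (simp only: exp_add[symmetric])
qed

section \<open>Random sets against a spread measure\<close>

definition mass :: "'v set \<Rightarrow> ('v \<Rightarrow> 'i \<Rightarrow> nat) \<Rightarrow> ('v \<Rightarrow> real) \<Rightarrow> 'i set \<Rightarrow> ('i \<Rightarrow> nat) \<Rightarrow> real" where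
  "mass I x w T \<beta> = (\<Sum>v | v \<in> I \<and> (\<forall>i\<in>T. x v i = \<beta> i). w v)"

lemma mass_restrict: "mass I x w T (restrict \<beta> T) = mass I x w T \<beta>"
  unfolding mass_def by (simp cong: ball_cong_simp)

lemma mass_nonneg: "(\<And>v. v \<in> I \<Longrightarrow> w v \<ge> 0) \<Longrightarrow> mass I x w T \<beta> \<ge> 0"
  unfolding mass_def by (rule sum_nonneg) blast

lemma sum_fibres_mass:
  assumes "finite I" and "\<And>v. v \<in> I \<Longrightarrow> x v i < m" and "i \<notin> T"
  shows "(\<Sum>v | v \<in> I \<and> (\<forall>i\<in>T. x v i = \<beta> i). w v * h (x v i)) =
    (\<Sum>a<m. h a * mass I x w (insert i T) (\<beta>(i := a)))"
proof -
  let ?I = "{v \<in> I. \<forall>i\<in>T. x v i = \<beta> i}"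
  have "(\<Sum>v\<in>?I. w v * h (x v i)) = (\<Sum>a<m. \<Sum>v | v \<in> ?I \<and> x v i = a. w v * h (x v i))"
    using assms(1,2) by (intro sum.group[symmetric]) auto
  also have "\<dots> = (\<Sum>a<m. h a * mass I x w (insert i T) (\<beta>(i := a)))"
  proof (rule sum.cong[OF refl])
    fix a
    have "{v. v \<in> ?I \<and> x v i = a} = {v. v \<in> I \<and> (\<forall>j\<in>insert i T. x v j = (\<beta>(i := a)) j)}"
      using \<open>i \<notin> T\<close> by auto
    then show "(\<Sum>v | v \<in> ?I \<and> x v i = a. w v * h (x v i)) = h a * mass I x w (insert i T) (\<beta>(i := a))"
      unfolding mass_def sum_distrib_left by (intro sum.cong) (auto simp: mult.commute)
  qed
  finally show ?thesis .
qed

text \<open>Deviation and variance are those of a cylinder fixing \<open>k\<close> coordinates. The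
  result is free of \<open>k\<close>, so one failure probability serves all cylinders.\<close>

lemma hoeffding_exponent:
  assumes "q > (0::real)" shows "- (\<epsilon> / q ^ k)\<^sup>2 / (2 * (4 / q ^ (2 * k + 1))) = - (\<epsilon>\<^sup>2 * q / 8)"
proof -
  have "q ^ (2 * k + 1) = q * (q ^ k)\<^sup>2"
    by (simp add: power_mult[symmetric] mult.commute)
  then show ?thesis
    using assms by (simp add: power_divide field_simps)
qed

text \<open>
  For a measure \<open>w\<close> on \<open>I\<close> none of whose projections is concentrated, almost all families \<open>y\<close> of subsets
  are met by some \<open>v\<close> with the prescribed pattern \<open>z\<close>. The sets \<open>y i\<close> are revealed one at a time: by
  Hoeffding's inequality, doubling the mass of the \<open>v\<close> that match \<open>z\<close> at \<open>i\<close> and deleting the others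
  changes the masses of all cylinders only slightly.
\<close>

lemma card_unmatched_le:
  fixes x :: "'v \<Rightarrow> 'i \<Rightarrow> nat" and z :: "'i \<Rightarrow> bool" and q \<epsilon> \<eta> c :: real
  assumes "finite I" and "m > 0" and "q > 0" and "\<epsilon> > 0"
  shows "finite J \<Longrightarrow> (\<And>v i. v \<in> I \<Longrightarrow> i \<in> J \<Longrightarrow> x v i < m) \<Longrightarrow>
    (\<And>v. v \<in> I \<Longrightarrow> w v \<ge> 0) \<Longrightarrow>
    (\<And>T \<beta>. T \<subseteq> J \<Longrightarrow> mass I x w T \<beta> \<le> c / q ^ card T) \<Longrightarrow>
    c + \<epsilon> * card J \<le> 2 \<Longrightarrow> mass I x w {} undefined > \<epsilon> * card J \<Longrightarrow>
    (real (2 * m) ^ card J + 1) * exp (- (\<epsilon>\<^sup>2 * q / 8)) \<le> \<eta> \<Longrightarrow>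
    card {y \<in> PiE J (\<lambda>_. Pow {..<m}). \<forall>v\<in>I. w v > 0 \<longrightarrow> (\<exists>i\<in>J. (x v i \<in> y i) \<noteq> z i)}
      \<le> card J * \<eta> * (2 ^ m) ^ card J"
proof (induction J arbitrary: w c rule: finite_induct)
  case empty
  then have "0 < (\<Sum>v\<in>I. w v)" by (simp add: mass_def)
  then obtain v where "v \<in> I" "w v > 0"
    by (meson not_le sum_nonpos)
  then show ?case by auto
next
  case (insert i J)
  note xm = insert.prems(1) and wt = insert.prems(2) and bound = insert.prems(3)
  note cJ = insert.prems(4) and total = insert.prems(5) and \<eta> = insert.prems(6)
  let ?M = "{..<m}"
  let ?e = "exp (- (\<epsilon>\<^sup>2 * q / 8))"
  define w' where "w' = (\<lambda>y0 v. w v * (if (x v i \<in> y0) = z i then 2 else 0))"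
  \<comment> \<open>\<open>u T \<beta> a\<close> is the mass of the fibre over the value
    \<open>a\<close> at \<open>i\<close>. Revealing \<open>y0\<close> changes the mass of a cylinder
    by a randomly signed sum of its fibres; \<open>sg\<close> orients the signs by
    \<open>z i\<close>.\<close>
  define u where "u = (\<lambda>T \<beta> a. mass I x w (insert i T) (\<beta>(i := a)))"
  define sg where "sg = (if z i then 1 else - 1 :: real)"
  define Bad where "Bad = (\<lambda>J (w :: 'v \<Rightarrow> real). {y \<in> PiE J (\<lambda>_. Pow ?M). \<forall>v\<in>I. w v > 0 \<longrightarrow> (\<exists>i\<in>J. (x v i \<in> y i) \<noteq> z i)})"
  have card_ins: "real (card (insert i J)) = card J + 1"
    using insert.hyps by simp
  have cJ': "c + \<epsilon> + \<epsilon> * card J \<le> 2" and total': "mass I x w {} undefined > \<epsilon> + \<epsilon> * card J"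
    using cJ total unfolding card_ins by (simp_all add: algebra_simps)
  have \<epsilon>J: "\<epsilon> * card J \<ge> 0"
    using \<open>\<epsilon> > 0\<close> by simp
  have cpos: "c > 0"
  proof -
    have "mass I x w {} undefined \<le> c" using bound[OF empty_subsetI, of undefined] by simp
    then show ?thesis using total' \<epsilon>J \<open>\<epsilon> > 0\<close> by linarith
  qed
  have cle: "c \<le> 2"
    using cJ' \<epsilon>J \<open>\<epsilon> > 0\<close> by linarith
  have mass_w': "mass I x (w' y0) T \<beta> =
      mass I x w T \<beta> + (\<Sum>a<m. if a \<in> y0 then sg * u T \<beta> a else - (sg * u T \<beta> a))"
    if "T \<subseteq> J" for y0 T \<beta>
  proof -
    have iT: "i \<notin> T" using that insert.hyps by auto
    have "mass I x (w' y0) T \<beta> =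
      (\<Sum>v | v \<in> I \<and> (\<forall>i\<in>T. x v i = \<beta> i). w v + w v * (if x v i \<in> y0 then sg else - sg))"
      unfolding mass_def w'_def by (rule sum.cong) (auto simp: sg_def)
    also have "\<dots> = mass I x w T \<beta> + (\<Sum>a<m. (if a \<in> y0 then sg else - sg) * u T \<beta> a)"
      unfolding sum.distrib u_def
      by (subst sum_fibres_mass[OF \<open>finite I\<close>, where m = m]) (auto simp: xm iT mass_def)
    also have "(\<Sum>a<m. (if a \<in> y0 then sg else - sg) * u T \<beta> a) =
        (\<Sum>a<m. if a \<in> y0 then sg * u T \<beta> a else - (sg * u T \<beta> a))"
      by (rule sum.cong) auto
    finally show ?thesis .
  qed
  have sum_u: "(\<Sum>a<m. u T \<beta> a) = mass I x w T \<beta>" if "T \<subseteq> J" for T \<beta>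
  proof -
    have "i \<notin> T" using that insert.hyps by auto
    then show ?thesis
      using sum_fibres_mass[OF \<open>finite I\<close>, where x = x and i = i and m = m and T = T and \<beta> = \<beta> and w = w and h = "\<lambda>_. 1"] xm
      by (simp add: u_def mass_def)
  qed
  \<comment> \<open>The sum of squares is at most the largest fibre times the total. The extra fixed
    coordinate \<open>i\<close> supplies the factor \<open>1 / q\<close> that makes the variance
    small.\<close>
  have sum_sq: "(\<Sum>a<m. (u T \<beta> a)\<^sup>2) \<le> 4 / q ^ (2 * card T + 1)" if "T \<subseteq> J" for T \<beta>
  proof -
    have "finite T" using that insert.hyps(1) by (rule finite_subset)
    have "i \<notin> T" using that insert.hyps by auto
    have "(u T \<beta> a)\<^sup>2 \<le> (2 / q ^ (card T + 1)) * u T \<beta> a" for a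
    proof -
      have "card (insert i T) = card T + 1"
        using \<open>finite T\<close> \<open>i \<notin> T\<close> by simp
      then have "u T \<beta> a \<le> c / q ^ (card T + 1)"
        using bound[OF insert_mono[OF that, of i], of "\<beta>(i := a)"] unfolding u_def by (simp only:)
      also have "\<dots> \<le> 2 / q ^ (card T + 1)"
        using cle \<open>q > 0\<close> by (intro divide_right_mono) auto
      finally have "u T \<beta> a \<le> 2 / q ^ (card T + 1)" .
      moreover have "u T \<beta> a \<ge> 0"
        unfolding u_def using wt by (rule mass_nonneg)
      ultimately show ?thesis
        unfolding power2_eq_square by (rule mult_right_mono)
    qed
    then have "(\<Sum>a<m. (u T \<beta> a)\<^sup>2) \<le> (2 / q ^ (card T + 1)) * mass I x w T \<beta>"
      unfolding sum_u[OF that, symmetric] sum_distrib_left by (rule sum_mono)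
    also have "\<dots> \<le> (2 / q ^ (card T + 1)) * (2 / q ^ card T)"
    proof (rule mult_left_mono)
      have "mass I x w T \<beta> \<le> c / q ^ card T" using that by (intro bound) auto
      also have "\<dots> \<le> 2 / q ^ card T"
        using cle \<open>q > 0\<close> by (intro divide_right_mono) auto
      finally show "mass I x w T \<beta> \<le> 2 / q ^ card T" .
    qed (use \<open>q > 0\<close> in simp)
    also have "\<dots> = 4 / q ^ (2 * card T + 1)"
      by (simp add: power_add mult_2)
    finally show ?thesis .
  qed
  \<comment> \<open>\<open>E\<close> holds the sets \<open>y0\<close> that raise some cylinder too
    much, \<open>E0\<close> those that lower the total mass too much.\<close>
  define E where "E = (\<lambda>(T, \<beta>). {y0 \<in> Pow ?M. \<epsilon> / q ^ card T \<le>
      (\<Sum>a<m. if a \<in> y0 then sg * u T \<beta> a else - (sg * u T \<beta> a))})"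
  define E0 where "E0 = {y0 \<in> Pow ?M. \<epsilon> \<le>
      (\<Sum>a<m. if a \<in> y0 then - sg * u {} undefined a else - (- sg * u {} undefined a))}"
  have sg2: "(sg * s)\<^sup>2 = s\<^sup>2" "(- sg * s)\<^sup>2 = s\<^sup>2" for s
    by (auto simp: sg_def)
  have card_E: "card (E (T, \<beta>)) \<le> 2 ^ m * ?e" if "T \<subseteq> J" for T \<beta>
  proof -
    have "(\<Sum>a<m. (sg * u T \<beta> a)\<^sup>2) \<le> 4 / q ^ (2 * card T + 1)"
      unfolding sg2 by (rule sum_sq[OF that])
    then show ?thesis
      using hoeffding_subsets[of ?M "\<epsilon> / q ^ card T" "4 / q ^ (2 * card T + 1)" "\<lambda>a. sg * u T \<beta> a"]
        \<open>q > 0\<close> \<open>\<epsilon> > 0\<close>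
      unfolding hoeffding_exponent[OF \<open>q > 0\<close>] E_def prod.case card_lessThan by auto
  qed
  have card_E0: "card E0 \<le> 2 ^ m * ?e"
  proof -
    have "(\<Sum>a<m. (- sg * u {} undefined a)\<^sup>2) \<le> 4 / q ^ (2 * card ({} :: 'i set) + 1)"
      unfolding sg2 by (rule sum_sq) simp
    then show ?thesis
      using hoeffding_subsets[of ?M "\<epsilon> / q ^ card ({} :: 'i set)" "4 / q ^ (2 * card ({} :: 'i set) + 1)" "\<lambda>a. - sg * u {} undefined a"]
        \<open>q > 0\<close> \<open>\<epsilon> > 0\<close>
      unfolding hoeffding_exponent[OF \<open>q > 0\<close>] E0_def card_lessThan by auto
  qed
  define Idx where "Idx = (SIGMA T : Pow J. PiE T (\<lambda>_. ?M))"
  define Y where "Y = E0 \<union> (\<Union>p\<in>Idx. E p)"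
  have finJ: "finite T" if "T \<in> Pow J" for T
    using that insert.hyps(1) by (auto intro: finite_subset)
  have finIdx: "finite Idx"
    unfolding Idx_def using insert.hyps finJ by (intro finite_SigmaI finite_PiE) auto
  have finE: "finite (E p)" for p by (cases p) (auto simp: E_def)
  have card_Idx: "card Idx \<le> (2 * m) ^ card J"
  proof -
    have "card Idx = (\<Sum>T\<in>Pow J. m ^ card T)"
      unfolding Idx_def using insert.hyps finJ
      by (subst card_SigmaI) (auto intro: finite_PiE simp: card_PiE)
    also have "\<dots> \<le> (\<Sum>T\<in>Pow J. m ^ card J)"
      using insert.hyps \<open>m > 0\<close> by (intro sum_mono power_increasing) (auto intro: card_mono)
    also have "\<dots> = (2 * m) ^ card J"
      using insert.hyps by (simp add: card_Pow power_mult_distrib)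
    finally show ?thesis .
  qed
  have card_Y: "card Y \<le> 2 ^ m * \<eta>"
  proof -
    have "card Y \<le> card E0 + (\<Sum>p\<in>Idx. card (E p))"
      unfolding Y_def by (intro order_trans[OF card_Un_le] add_left_mono card_UN_le finIdx)
    then have "real (card Y) \<le> card E0 + (\<Sum>p\<in>Idx. real (card (E p)))"
      by (metis of_nat_add of_nat_mono of_nat_sum)
    also have "\<dots> \<le> 2 ^ m * ?e + (\<Sum>p\<in>Idx. 2 ^ m * ?e)"
      using card_E by (intro add_mono card_E0 sum_mono) (auto simp: Idx_def)
    also have "\<dots> = 2 ^ m * ((card Idx + 1) * ?e)"
      by (simp add: algebra_simps)
    also have "\<dots> \<le> 2 ^ m * ((real (2 * m) ^ card (insert i J) + 1) * ?e)"
    proof -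
      have "real (card Idx) \<le> real (2 * m) ^ card J"
        using card_Idx by (metis of_nat_mono of_nat_power)
      also have "\<dots> \<le> real (2 * m) ^ card (insert i J)"
        using \<open>m > 0\<close> insert.hyps by (intro power_increasing) auto
      finally show ?thesis by (intro mult_left_mono mult_right_mono) auto
    qed
    also have "\<dots> \<le> 2 ^ m * \<eta>"
      using \<eta> by (intro mult_left_mono) auto
    finally show ?thesis .
  qed
  have good: "card (Bad J (w' y0)) \<le> card J * \<eta> * (2 ^ m) ^ card J"
    if y0: "y0 \<in> Pow ?M - Y" for y0
    unfolding Bad_def
  proof (rule insert.IH[where c = "c + \<epsilon>"])
    show "x v j < m" if "v \<in> I" "j \<in> J" for v j using xm that by auto
    show "w' y0 v \<ge> 0" if "v \<in> I" for v using wt that by (auto simp: w'_def)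
    show "c + \<epsilon> + \<epsilon> * card J \<le> 2" by (fact cJ')
    show "mass I x (w' y0) {} undefined > \<epsilon> * card J"
    proof -
      have "(\<Sum>a<m. if a \<in> y0 then sg * u {} undefined a else - (sg * u {} undefined a)) =
          - (\<Sum>a<m. if a \<in> y0 then - sg * u {} undefined a else - (- sg * u {} undefined a))"
        unfolding sum_negf[symmetric] by (rule sum.cong) auto
      moreover have "y0 \<notin> E0" using y0 by (simp add: Y_def)
      ultimately show ?thesis
        using total' y0 unfolding mass_w'[OF empty_subsetI] E0_def by simp
    qed
    show "(real (2 * m) ^ card J + 1) * ?e \<le> \<eta>"
    proof -
      have "real (2 * m) ^ card J \<le> real (2 * m) ^ card (insert i J)"
        using \<open>m > 0\<close> insert.hyps by (intro power_increasing) auto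
      then show ?thesis using \<eta> by (smt (verit) exp_gt_zero mult_right_mono)
    qed
    show "mass I x (w' y0) T \<beta> \<le> (c + \<epsilon>) / q ^ card T" if T: "T \<subseteq> J" for T \<beta>
    proof (cases "\<forall>j\<in>T. \<beta> j < m")
      case True
      let ?\<beta> = "restrict \<beta> T"
      have "(T, ?\<beta>) \<in> Idx" using True T by (auto simp: Idx_def)
      then have "y0 \<notin> E (T, ?\<beta>)" using y0 by (auto simp: Y_def)
      then have "mass I x (w' y0) T ?\<beta> \<le> mass I x w T ?\<beta> + \<epsilon> / q ^ card T"
        using y0 unfolding mass_w'[OF T] by (auto simp: E_def)
      moreover have "mass I x w T ?\<beta> \<le> c / q ^ card T"
        using T by (intro bound) auto
      ultimately show ?thesis
        unfolding mass_restrict by (simp add: add_divide_distrib)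
    next
      case False
      then have "{v \<in> I. \<forall>i\<in>T. x v i = \<beta> i} = {}"
        using xm T by fastforce
      then show ?thesis
        unfolding mass_def using cpos \<open>\<epsilon> > 0\<close> \<open>q > 0\<close> by (simp only: sum.empty) simp
    qed
  qed
  have finPi: "finite (PiE J (\<lambda>_. Pow ?M))"
    using insert.hyps by (intro finite_PiE) auto
  have cardPi: "card (PiE J (\<lambda>_. Pow ?M)) = (2 ^ m) ^ card J"
    using insert.hyps by (simp add: card_PiE card_Pow)
  have finBad: "finite (Bad J w'')" for w''
    unfolding Bad_def using finPi by auto
  \<comment> \<open>Every \<open>v\<close> with positive weight in \<open>w' y0\<close> already
    matches \<open>z\<close> at \<open>i\<close>, so a mismatch with \<open>y\<close> must occur
    within \<open>J\<close>.\<close>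
  have sub: "Bad (insert i J) w \<subseteq> (\<Union>y0\<in>Pow ?M. (\<lambda>y. y(i := y0)) ` Bad J (w' y0))"
  proof
    fix y assume y: "y \<in> Bad (insert i J) w"
    then have "y \<in> PiE (insert i J) (\<lambda>_. Pow ?M)" by (simp add: Bad_def)
    then obtain y0 g where y0: "y0 \<in> Pow ?M" "g \<in> PiE J (\<lambda>_. Pow ?M)" "y = g(i := y0)"
      unfolding PiE_insert_eq by auto
    have "g \<in> Bad J (w' y0)"
      unfolding Bad_def
    proof (intro CollectI conjI ballI impI)
      fix v assume v: "v \<in> I" "w' y0 v > 0"
      then have "w v > 0" and eq: "(x v i \<in> y0) = z i"
        using wt[of v] by (auto simp: w'_def split: if_splits)
      have "\<exists>j\<in>insert i J. (x v j \<in> y j) \<noteq> z j"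
        using y \<open>v \<in> I\<close> \<open>w v > 0\<close> unfolding Bad_def by blast
      then obtain j where "j \<in> insert i J" "(x v j \<in> y j) \<noteq> z j" ..
      then show "\<exists>j\<in>J. (x v j \<in> g j) \<noteq> z j"
        using eq y0 by (cases "j = i") auto
    qed (use y0 in auto)
    then show "y \<in> (\<Union>y0\<in>Pow ?M. (\<lambda>y. y(i := y0)) ` Bad J (w' y0))"
      using y0 by blast
  qed
  have "card (Bad (insert i J) w) \<le> card (\<Union>y0\<in>Pow ?M. (\<lambda>y. y(i := y0)) ` Bad J (w' y0))"
    using sub finBad by (intro card_mono) auto
  also have "\<dots> \<le> (\<Sum>y0\<in>Pow ?M. card ((\<lambda>y. y(i := y0)) ` Bad J (w' y0)))"
    by (rule card_UN_le) simp
  also have "\<dots> \<le> (\<Sum>y0\<in>Pow ?M. card (Bad J (w' y0)))"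
    by (intro sum_mono card_image_le finBad)
  finally have "real (card (Bad (insert i J) w)) \<le> (\<Sum>y0\<in>Pow ?M. real (card (Bad J (w' y0))))"
    by (metis of_nat_mono of_nat_sum)
  also have "\<dots> = (\<Sum>y0\<in>Y. real (card (Bad J (w' y0)))) + (\<Sum>y0\<in>Pow ?M - Y. real (card (Bad J (w' y0))))"
    by (subst add.commute, rule sum.subset_diff) (auto simp: Y_def E_def E0_def)
  \<comment> \<open>For the exceptional \<open>y0\<close> in \<open>Y\<close> every continuation is
    counted as bad; they are rare enough to cost a single \<open>\<eta>\<close>.\<close>
  also have "\<dots> \<le> (\<Sum>y0\<in>Y. (2 ^ m) ^ card J) + (\<Sum>y0\<in>Pow ?M - Y. card J * \<eta> * (2 ^ m) ^ card J)"
  proof (intro add_mono sum_mono good)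
    fix y0
    have "card (Bad J (w' y0)) \<le> (2 ^ m) ^ card J"
      unfolding cardPi[symmetric] Bad_def by (intro card_mono finPi) auto
    then show "real (card (Bad J (w' y0))) \<le> (2 ^ m) ^ card J"
      by (metis of_nat_le_iff of_nat_numeral of_nat_power)
  qed auto
  also have "\<dots> \<le> 2 ^ m * \<eta> * (2 ^ m) ^ card J + 2 ^ m * (card J * \<eta> * (2 ^ m) ^ card J)"
  proof (rule add_mono)
    show "(\<Sum>y0\<in>Y. (2 ^ m) ^ card J) \<le> 2 ^ m * \<eta> * (2 ^ m) ^ card J"
      using card_Y by (simp add: mult_right_mono)
    have "\<eta> \<ge> 0" using \<eta> by (smt (verit) exp_gt_zero mult_nonneg_nonneg of_nat_0_le_iff zero_le_power)
    have "card (Pow ?M - Y) \<le> 2 ^ m"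
      using card_mono[of "Pow ?M" "Pow ?M - Y"] by (simp add: card_Pow)
    then have "real (card (Pow ?M - Y)) \<le> 2 ^ m"
      by (metis of_nat_le_iff of_nat_numeral of_nat_power)
    then show "(\<Sum>y0\<in>Pow ?M - Y. card J * \<eta> * (2 ^ m) ^ card J) \<le> 2 ^ m * (card J * \<eta> * (2 ^ m) ^ card J)"
      using \<open>\<eta> \<ge> 0\<close> by (simp add: mult_right_mono)
  qed
  also have "\<dots> = card (insert i J) * \<eta> * (2 ^ m) ^ card (insert i J)"
    using insert.hyps by (simp add: algebra_simps)
  finally show ?case by (simp add: Bad_def)
qed

section \<open>Independent sets of hard inputs\<close>

text \<open>
  The index gadget: one player holds \<open>x i < m\<close>, the other a set \<open>Y i\<close> of indices, and the \<open>i\<close>-th bit is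
  \<open>x i \<in> Y i\<close>. The hard inputs are those that encode the all-zero string.
\<close>

definition hard_inputs :: "'i set \<Rightarrow> nat \<Rightarrow> (('i \<Rightarrow> nat) \<times> ('i \<Rightarrow> nat set)) set" where
  "hard_inputs J m = (SIGMA x : PiE J (\<lambda>_. {..<m}). PiE J (\<lambda>i. Pow ({..<m} - {x i})))"

lemma finite_hard_inputs: "finite J \<Longrightarrow> finite (hard_inputs J m)"
  unfolding hard_inputs_def by (intro finite_SigmaI finite_PiE) auto

lemma card_avoiding:
  assumes "finite J" and "x \<in> PiE J (\<lambda>_. {..<m})"
  shows "card (PiE J (\<lambda>i. Pow ({..<m} - {x i}))) = (2 ^ (m - 1)) ^ card J"
proof -
  have "card (Pow ({..<m} - {x i})) = 2 ^ (m - 1)" if "i \<in> J" for i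
    using PiE_mem[OF assms(2) that] by (simp add: card_Pow)
  then show ?thesis
    using assms(1) by (simp add: card_PiE)
qed

lemma card_hard_inputs:
  assumes "finite J" shows "card (hard_inputs J m) = m ^ card J * (2 ^ (m - 1)) ^ card J"
  unfolding hard_inputs_def using assms
  by (subst card_SigmaI) (auto intro!: finite_PiE simp: card_avoiding card_PiE)

lemma card_PiE_fixed:
  assumes "finite J" and "finite A" and "S \<subseteq> J"
  shows "card {x \<in> PiE J (\<lambda>_. A). \<forall>i\<in>S. x i = \<alpha> i} \<le> card A ^ (card J - card S)" (is "card ?X \<le> _")
proof -
  have "inj_on (\<lambda>x. restrict x (J - S)) ?X"
  proof (rule inj_onI)
    fix x y assume x: "x \<in> ?X" and y: "y \<in> ?X" and eq: "restrict x (J - S) = restrict y (J - S)"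
    show "x = y"
    proof (rule PiE_ext[of x J "\<lambda>_. A" y])
      fix i assume "i \<in> J"
      then show "x i = y i"
        using x y fun_cong[OF eq, of i] by (cases "i \<in> S") auto
    qed (use x y in auto)
  qed
  moreover have "(\<lambda>x. restrict x (J - S)) ` ?X \<subseteq> PiE (J - S) (\<lambda>_. A)"
    by auto
  moreover have "finite (PiE (J - S) (\<lambda>_. A))"
    using assms by (intro finite_PiE) auto
  ultimately have "card ?X \<le> card (PiE (J - S) (\<lambda>_. A))"
    by (rule card_inj_on_le)
  also have "\<dots> = card A ^ (card J - card S)"
    using assms by (simp add: card_PiE card_Diff_subset finite_subset[OF assms(3)])
  finally show ?thesis .
qed

text \<open>
  In the proof, \<open>S\<close> is a largest set of coordinates of \<open>x\<close> that can be fixed while keeping more of \<open>I\<close>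
  than expected. It has at most \<open>D\<close> elements, so some certificate has no ones in \<open>S\<close>, and outside of \<open>S\<close>
  the remaining \<open>x\<close> are spread enough to realise this certificate.
\<close>

lemma independent_hard_inputs:
  fixes J :: "'i set" and U :: "('i set \<times> 'i set) set" and s D :: nat
  assumes J: "finite J" "card J = n" "n > 0" and s: "s \<ge> 2" and D: "D \<le> n"
    and U: "\<And>A Z. (A, Z) \<in> U \<Longrightarrow> A \<subseteq> J \<and> Z \<subseteq> J \<and> A \<inter> Z = {}"
    and avoid: "\<And>S. S \<subseteq> J \<Longrightarrow> card S \<le> D \<Longrightarrow> \<exists>A Z. (A, Z) \<in> U \<and> A \<inter> S = {}"
    and num: "2 ^ n * real s ^ n * n * ((real (2 * s\<^sup>2) ^ n + 1) * exp (- (s / (32 * (real n)\<^sup>2)))) < 1"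
    and I: "I \<subseteq> hard_inputs J (s\<^sup>2)"
    and indep: "\<And>x Y x' Y' A Z. (x, Y) \<in> I \<Longrightarrow> (x', Y') \<in> I \<Longrightarrow> (A, Z) \<in> U \<Longrightarrow>
      (\<forall>i\<in>A. x i \<in> Y' i) \<Longrightarrow> (\<forall>i\<in>Z. x i \<notin> Y' i) \<Longrightarrow> False"
  shows "card I * s ^ D \<le> card (hard_inputs J (s\<^sup>2))"
proof (rule ccontr)
  assume large: "\<not> ?thesis"
  define m where "m = s\<^sup>2"
  let ?M = "{..<m}"
  have "m > 0" using s by (simp add: m_def)
  define V where "V = hard_inputs J m"
  define R :: nat where "R = (2 ^ (m - 1)) ^ n"
  have cardV: "card V = m ^ n * R"
    using J by (simp add: V_def R_def card_hard_inputs)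
  have "R > 0" by (simp add: R_def)
  have finI: "finite I"
    using I J finite_hard_inputs finite_subset by metis
  define fib where "fib = (\<lambda>S \<alpha>. {v \<in> I. \<forall>i\<in>S. fst v i = \<alpha> i})"
  \<comment> \<open>The gadget size is \<open>s\<^sup>2\<close>, so fixing \<open>k\<close>
    coordinates is expected to cost \<open>s ^ (2 * k)\<close>. \<open>P k\<close> asks for a fibre
    that loses at most \<open>s ^ k\<close> from the assumed density
    \<open>1 / s ^ D\<close>.\<close>
  define P where "P = (\<lambda>k. \<exists>S \<alpha>. S \<subseteq> J \<and> card S = k \<and> card V \<le> card (fib S \<alpha>) * s ^ (D + k))"
  have "P 0"
    unfolding P_def using large by (intro exI[of _ "{}"]) (auto simp: fib_def V_def m_def)
  moreover have "k < Suc n" if "P k" for k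
    using that J by (auto simp: P_def less_Suc_eq_le intro: card_mono)
  ultimately obtain k where Pk: "P k" and max: "\<And>l. P l \<Longrightarrow> l \<le> k"
    using ex_has_greatest_nat[of P 0 "\<lambda>k. k" "Suc n"] by auto
  then obtain S \<alpha> where S: "S \<subseteq> J" "card S = k" and big: "card V \<le> card (fib S \<alpha>) * s ^ (D + k)"
    unfolding P_def by auto
  define I' where "I' = fib S \<alpha>"
  have I'I: "I' \<subseteq> I" by (auto simp: I'_def fib_def)
  then have finI': "finite I'" using finI finite_subset by auto
  have "k \<le> n" using S J by (metis card_mono)
  define X where "X = {x \<in> PiE J (\<lambda>_. ?M). \<forall>i\<in>S. x i = \<alpha> i}"
  have finX: "finite X"
    unfolding X_def using J by (intro finite_Collect_conjI disjI1) (auto intro: finite_PiE)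
  have cardX: "card X \<le> m ^ (n - k)"
    using card_PiE_fixed[of J ?M S \<alpha>] J S by (simp add: X_def)
  have I'X: "fst v \<in> X" "snd v \<in> PiE J (\<lambda>i. Pow (?M - {fst v i}))" if "v \<in> I'" for v
  proof -
    have "v \<in> hard_inputs J m" using that I I'I by (auto simp: m_def)
    then show "fst v \<in> X" "snd v \<in> PiE J (\<lambda>i. Pow (?M - {fst v i}))"
      using that by (cases v; simp add: I'_def fib_def X_def hard_inputs_def)+
  qed
  have "card V > 0" using cardV \<open>m > 0\<close> \<open>R > 0\<close> by simp
  then have I'pos: "card I' > 0" using big by (auto simp: I'_def intro!: Nat.gr0I)
  have s_split: "m ^ n = m ^ (n - k) * s ^ k * s ^ k"
    using \<open>k \<le> n\<close>
    by (simp add: m_def power_mult_distrib power2_eq_square flip: power_add mult.assoc)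
  \<comment> \<open>The fibre has density at most \<open>1 / s ^ (2 * k)\<close> among the hard
    inputs, but at least \<open>1 / s ^ (D + k)\<close> by choice.\<close>
  have "k \<le> D"
  proof -
    have "I' \<subseteq> (SIGMA x : X. PiE J (\<lambda>i. Pow (?M - {x i})))"
      using I'X by fastforce
    then have "card I' \<le> card (SIGMA x : X. PiE J (\<lambda>i. Pow (?M - {x i})))"
      using finX J by (intro card_mono finite_SigmaI finite_PiE) auto
    also have "\<dots> = card X * R"
      using finX J by (subst card_SigmaI) (auto intro!: finite_PiE simp: card_avoiding X_def R_def)
    also have "\<dots> \<le> m ^ (n - k) * R" using cardX by simp
    finally have "card V \<le> m ^ (n - k) * R * s ^ (D + k)"
      using big by (metis I'_def le_trans mult_le_mono1)
    then have "(m ^ (n - k) * R) * (s ^ k * s ^ k) \<le> (m ^ (n - k) * R) * s ^ (D + k)"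
      unfolding cardV s_split by (simp only: ac_simps)
    then have "s ^ (k + k) \<le> s ^ (D + k)"
      using \<open>m > 0\<close> \<open>R > 0\<close> by (simp add: power_add)
    then show ?thesis
      using s power_le_imp_le_exp[of s "k + k" "D + k"] by simp
  qed
  \<comment> \<open>Maximality of \<open>k\<close>: each further fixed coordinate costs at least a
    factor \<open>s\<close>. This is the spread that \<open>card_unmatched_le\<close> wants, with
    \<open>q = s\<close>.\<close>
  have bound: "card {v \<in> I'. \<forall>i\<in>T. fst v i = \<beta> i} * s ^ card T \<le> card I'"
    if T: "T \<subseteq> J - S" for T \<beta>
  proof (cases "T = {}")
    case False
    define \<gamma> where "\<gamma> = (\<lambda>i. if i \<in> S then \<alpha> i else \<beta> i)"
    have finT: "finite T" "finite S" using T S J finite_subset by (metis finite_Diff, metis)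
    have eq: "{v \<in> I'. \<forall>i\<in>T. fst v i = \<beta> i} = fib (S \<union> T) \<gamma>"
      using T by (fastforce simp: I'_def fib_def \<gamma>_def)
    have card_ST: "card (S \<union> T) = k + card T"
      using T S finT by (subst card_Un_disjoint) auto
    have "\<not> P (k + card T)"
      using max[of "k + card T"] False finT by (auto simp: card_gt_0_iff)
    then have "\<not> card V \<le> card (fib (S \<union> T) \<gamma>) * s ^ (D + (k + card T))"
      using T S card_ST unfolding P_def by blast
    moreover have "s ^ (D + (k + card T)) = s ^ card T * s ^ (D + k)"
      by (simp only: power_add ac_simps)
    ultimately have "card (fib (S \<union> T) \<gamma>) * s ^ card T * s ^ (D + k) \<le> card I' * s ^ (D + k)"
      using big unfolding I'_def by (simp only: mult.assoc not_le)
    then show ?thesis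
      unfolding eq using s by simp
  qed simp
  define J' where "J' = J - S"
  have J': "finite J'" "card J' = n - k"
    using J S by (auto simp: J'_def card_Diff_subset finite_subset[OF S(1)])
  obtain A Z where AZ: "(A, Z) \<in> U" "A \<inter> S = {}"
    using avoid[of S] S \<open>k \<le> D\<close> by auto
  define w where "w = (\<lambda>_ :: ('i \<Rightarrow> nat) \<times> ('i \<Rightarrow> nat set). 1 / real (card I'))"
  \<comment> \<open>The errors of all rounds add up to at most 1/2, so the spread constant,
    initially 1, stays below 2 and the total mass, initially 1, stays positive.\<close>
  define \<epsilon> where "\<epsilon> = 1 / (2 * real n)"
  define \<eta> where "\<eta> = (real (2 * m) ^ n + 1) * exp (- (\<epsilon>\<^sup>2 * s / 8))"
  define Bad where "Bad = {y \<in> PiE J' (\<lambda>_. Pow ?M). \<forall>v\<in>I'. w v > 0 \<longrightarrow> (\<exists>i\<in>J'. (fst v i \<in> y i) \<noteq> (i \<in> A))}"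
  have mass_eq: "mass I' fst w T \<beta> = card {v \<in> I'. \<forall>i\<in>T. fst v i = \<beta> i} / card I'" for T \<beta>
    by (simp add: mass_def w_def)
  have \<epsilon>J': "\<epsilon> * card J' \<le> 1 / 2"
    using J J' by (simp add: \<epsilon>_def field_simps)
  have "card Bad \<le> card J' * \<eta> * (2 ^ m) ^ card J'"
    unfolding Bad_def
  proof (rule card_unmatched_le[where \<epsilon> = \<epsilon> and q = s and c = 1])
    show "fst v i < m" if "v \<in> I'" "i \<in> J'" for v i
      using I'X(1)[OF that(1)] that(2) by (auto simp: X_def J'_def)
    show "mass I' fst w T \<beta> \<le> 1 / real s ^ card T" if "T \<subseteq> J'" for T \<beta>
    proof -
      have "real (card {v \<in> I'. \<forall>i\<in>T. fst v i = \<beta> i}) * real s ^ card T \<le> real (card I')"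
        using of_nat_mono[OF bound[OF that[unfolded J'_def], of \<beta>], where 'a = real] by simp
      then show ?thesis
        using s I'pos by (simp add: mass_eq field_simps)
    qed
    show "mass I' fst w {} undefined > \<epsilon> * card J'"
      using \<epsilon>J' I'pos by (simp add: mass_eq)
    have "real (2 * m) ^ card J' \<le> real (2 * m) ^ n"
      using J' \<open>m > 0\<close> by (intro power_increasing) auto
    then show "(real (2 * m) ^ card J' + 1) * exp (- (\<epsilon>\<^sup>2 * s / 8)) \<le> \<eta>"
      unfolding \<eta>_def by (intro mult_right_mono) auto
    show "\<epsilon> > 0" using J by (simp add: \<epsilon>_def)
    show "1 + \<epsilon> * card J' \<le> 2" using \<epsilon>J' by simp
  qed (use finI' J' s \<open>m > 0\<close> in \<open>simp_all add: w_def\<close>)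
  define B' where "B' = snd ` I'"
  \<comment> \<open>If some \<open>v\<close> realised the ones of \<open>A\<close> against
    \<open>Y\<close> outside \<open>S\<close>, then \<open>v\<close> and the owner \<open>v0\<close>
    of \<open>Y\<close> would violate independence.\<close>
  have "B' \<subseteq> {Y \<in> PiE J (\<lambda>_. Pow ?M). restrict Y J' \<in> Bad}"
  proof
    fix Y assume "Y \<in> B'"
    then obtain v0 where v0: "v0 \<in> I'" "Y = snd v0" by (auto simp: B'_def)
    have Y: "Y \<in> PiE J (\<lambda>_. Pow ?M)"
      using I'X(2)[OF v0(1)] v0(2) by (auto simp: PiE_iff)
    have "\<exists>i\<in>J'. (fst v i \<in> Y i) \<noteq> (i \<in> A)" if v: "v \<in> I'" for v
    proof (rule ccontr)
      assume "\<not> ?thesis"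
      then have match: "\<And>i. i \<in> J' \<Longrightarrow> fst v i \<in> Y i \<longleftrightarrow> i \<in> A" by blast
      show False
      proof (rule indep[of "fst v" "snd v" "fst v0" Y A Z])
        show "\<forall>i\<in>A. fst v i \<in> Y i"
          using match U[OF AZ(1)] AZ(2) by (auto simp: J'_def)
        show "\<forall>i\<in>Z. fst v i \<notin> Y i"
        proof
          fix i assume i: "i \<in> Z"
          show "fst v i \<notin> Y i"
          proof (cases "i \<in> S")
            case True
            \<comment> \<open>On \<open>S\<close> all first components in \<open>I'\<close> agree,
              so this bit is the one that \<open>v0\<close> computes from its own \<open>Y\<close>,
              which is zero. Hence \<open>Z\<close> may meet \<open>S\<close>; only \<open>A\<close>
              must avoid it.\<close>
            then have "fst v i = fst v0 i" using v v0(1) by (simp add: I'_def fib_def)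
            moreover have "fst v0 i \<notin> Y i"
              using I'X(2)[OF v0(1)] v0(2) True S by (auto simp: PiE_iff)
            ultimately show ?thesis by simp
          next
            case False
            then show ?thesis using match[of i] U[OF AZ(1)] i by (auto simp: J'_def)
          qed
        qed
      qed (use v v0 I'I AZ in auto)
    qed
    then have "restrict Y J' \<in> Bad"
      using Y by (auto simp: Bad_def J'_def)
    then show "Y \<in> {Y \<in> PiE J (\<lambda>_. Pow ?M). restrict Y J' \<in> Bad}"
      using Y by blast
  qed
  have "finite Bad"
    unfolding Bad_def using J' by (intro finite_Collect_conjI disjI1) (auto intro: finite_PiE)
  have finS: "finite S" using S J finite_subset by auto
  have "card B' \<le> card (Bad \<times> PiE S (\<lambda>_. Pow ?M))"
  proof (rule card_inj_on_le)
    show "inj_on (\<lambda>Y. (restrict Y J', restrict Y S)) B'"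
    proof (rule inj_onI)
      fix Y Y' assume Y: "Y \<in> B'" "Y' \<in> B'"
        and eq: "(restrict Y J', restrict Y S) = (restrict Y' J', restrict Y' S)"
      have "Y \<in> PiE J (\<lambda>_. Pow ?M)" "Y' \<in> PiE J (\<lambda>_. Pow ?M)"
        using Y \<open>B' \<subseteq> _\<close> by auto
      then show "Y = Y'"
      proof (rule PiE_ext)
        fix i assume "i \<in> J"
        have "restrict Y J' i = restrict Y' J' i" "restrict Y S i = restrict Y' S i"
          using eq by simp_all
        then show "Y i = Y' i"
          using \<open>i \<in> J\<close> by (cases "i \<in> S") (simp_all add: J'_def)
      qed
    qed
    show "(\<lambda>Y. (restrict Y J', restrict Y S)) ` B' \<subseteq> Bad \<times> PiE S (\<lambda>_. Pow ?M)"
    proof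
      fix p assume "p \<in> (\<lambda>Y. (restrict Y J', restrict Y S)) ` B'"
      then obtain Y where Y: "Y \<in> B'" "p = (restrict Y J', restrict Y S)" by blast
      then have "Y \<in> PiE J (\<lambda>_. Pow ?M)" "restrict Y J' \<in> Bad"
        using \<open>B' \<subseteq> _\<close> by auto
      moreover from this(1) have "restrict Y S \<in> PiE S (\<lambda>_. Pow ?M)"
        using S(1) unfolding restrict_PiE_iff by (blast dest: PiE_mem)
      ultimately show "p \<in> Bad \<times> PiE S (\<lambda>_. Pow ?M)"
        using Y(2) by simp
    qed
    show "finite (Bad \<times> PiE S (\<lambda>_. Pow ?M))"
      using \<open>finite Bad\<close> finS by (intro finite_cartesian_product finite_PiE) auto
  qed
  also have "\<dots> = card Bad * (2 ^ m) ^ k"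
    using finS S by (simp add: card_cartesian_product card_PiE card_Pow)
  finally have cardB': "card B' \<le> card Bad * (2 ^ m) ^ k" .
  have "card I' \<le> card (X \<times> B')"
    using I'X(1) finX finI' by (intro card_mono) (force simp: B'_def)+
  then have "card I' \<le> m ^ (n - k) * (card Bad * (2 ^ m) ^ k)"
    unfolding card_cartesian_product using cardX cardB' by (meson le_trans mult_le_mono)
  then have "card V \<le> m ^ (n - k) * (card Bad * (2 ^ m) ^ k) * s ^ (D + k)"
    using big by (metis I'_def le_trans mult_le_mono1)
  then have "(m ^ (n - k) * s ^ k) * (s ^ k * R) \<le> (m ^ (n - k) * s ^ k) * (card Bad * (2 ^ m) ^ k * s ^ D)"
    unfolding cardV s_split by (simp only: ac_simps power_add)
  then have "s ^ k * R \<le> card Bad * (2 ^ m) ^ k * s ^ D"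
    using \<open>m > 0\<close> s by simp
  moreover have "R \<le> s ^ k * R" using s by simp
  ultimately have "R \<le> card Bad * (2 ^ m) ^ k * s ^ D" by linarith
  then have "real R \<le> real (card Bad * (2 ^ m) ^ k * s ^ D)"
    by (simp only: of_nat_le_iff)
  also have "\<dots> = real (card Bad) * (2 ^ m) ^ k * real s ^ D"
    by simp
  also have "\<dots> \<le> (card J' * \<eta> * (2 ^ m) ^ card J') * (2 ^ m) ^ k * real s ^ n"
    using \<open>card Bad \<le> card J' * \<eta> * (2 ^ m) ^ card J'\<close> s D
    by (intro mult_mono mult_right_mono power_increasing) (auto simp: \<eta>_def)
  also have "\<dots> = (card J' * \<eta>) * real s ^ n * (2 ^ m) ^ n"
    using J' \<open>k \<le> n\<close> by (simp flip: power_add)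
  also have "\<dots> \<le> (n * \<eta>) * real s ^ n * (2 ^ m) ^ n"
    using J' \<open>k \<le> n\<close> by (intro mult_right_mono) (auto simp: \<eta>_def)
  \<comment> \<open>A hard input bars one index from each set, hence the factor \<open>2 ^ n\<close>
    between all families of sets and the \<open>R\<close> admissible ones.\<close>
  also have "(2 ^ m) ^ n = 2 ^ n * real R"
    using \<open>m > 0\<close> by (simp add: R_def flip: power_mult_distrib power_Suc)
  also have "n * \<eta> * real s ^ n * (2 ^ n * real R) = (2 ^ n * real s ^ n * n * \<eta>) * real R"
    by (simp only: ac_simps)
  also have "\<dots> < 1 * real R"
  proof (rule mult_strict_right_mono)
    have "\<epsilon>\<^sup>2 * s / 8 = s / (32 * (real n)\<^sup>2)"
      by (simp add: \<epsilon>_def power_divide power_mult_distrib)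
    then show "2 ^ n * real s ^ n * n * \<eta> < 1"
      using num by (simp add: \<eta>_def m_def)
  qed (use \<open>R > 0\<close> in simp)
  finally show False by simp
qed

section \<open>Graphs from systems of bicliques\<close>

definition biarcs :: "'v set \<Rightarrow> 'v set \<Rightarrow> ('v \<times> 'v) set" where
  "biarcs A B = A \<times> B \<union> B \<times> A"

text \<open>Sides may be empty, so that intersections can be formed freely; such bicliques are
  discarded when the graph is built.\<close>

definition biclique_system :: "'v set \<Rightarrow> 'k set \<Rightarrow> ('k \<Rightarrow> 'v set) \<Rightarrow> ('k \<Rightarrow> 'v set) \<Rightarrow> bool" where
  "biclique_system W K A B \<longleftrightarrow> finite W \<and> finite K \<and>
     (\<forall>i\<in>K. A i \<subseteq> W \<and> B i \<subseteq> W \<and> A i \<inter> B i = {}) \<and>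
     (\<forall>i\<in>K. \<forall>j\<in>K. i \<noteq> j \<longrightarrow> biarcs (A i) (B i) \<inter> biarcs (A j) (B j) = {})"

definition system_arcs :: "'k set \<Rightarrow> ('k \<Rightarrow> 'v set) \<Rightarrow> ('k \<Rightarrow> 'v set) \<Rightarrow> ('v \<times> 'v) set" where
  "system_arcs K A B = (\<Union>i\<in>K. biarcs (A i) (B i))"

text \<open>A chromatic lower bound for bare arc sets, which lets the vertex type change before a
  graph is formed.\<close>

definition needs_colours :: "'v set \<Rightarrow> ('v \<times> 'v) set \<Rightarrow> nat \<Rightarrow> bool" where
  "needs_colours W E X \<longleftrightarrow>
     (\<forall>(c :: 'v \<Rightarrow> nat) N. (\<forall>v\<in>W. c v < N) \<longrightarrow> (\<forall>(u, v)\<in>E. c u \<noteq> c v) \<longrightarrow> X \<le> N)"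

text \<open>Colour classes are independent, so each contains at most a fraction \<open>1 / X\<close>
  of \<open>W\<close>.\<close>

lemma needs_colours_if_independent_small:
  assumes "finite W" "W \<noteq> {}"
    and small: "\<And>I. I \<subseteq> W \<Longrightarrow> (\<And>u v. u \<in> I \<Longrightarrow> v \<in> I \<Longrightarrow> (u, v) \<notin> E) \<Longrightarrow> card I * X \<le> card W"
  shows "needs_colours W E X"
  unfolding needs_colours_def
proof (intro allI impI)
  fix c :: "'a \<Rightarrow> nat" and N
  assume range: "\<forall>v\<in>W. c v < N" and proper: "\<forall>(u, v)\<in>E. c u \<noteq> c v"
  let ?I = "\<lambda>j. {v \<in> W. c v = j}"
  have "card W = (\<Sum>j<N. card (?I j))"
    using sum.group[of W "{..<N}" c "\<lambda>_. 1::nat"] \<open>finite W\<close> range by (auto simp: image_subset_iff)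
  then have "card W * X = (\<Sum>j<N. card (?I j) * X)"
    by (simp add: sum_distrib_right)
  also have "\<dots> \<le> (\<Sum>j<N. card W)"
  proof (rule sum_mono)
    fix j
    show "card (?I j) * X \<le> card W"
    proof (rule small)
      show "(u, v) \<notin> E" if "u \<in> ?I j" "v \<in> ?I j" for u v
        using that proper by fastforce
    qed blast
  qed
  finally show "X \<le> N"
    using assms(1,2) by (simp add: card_gt_0_iff)
qed

text \<open>
  A directed cover by bicliques may use an edge once in each direction. Either the graph of the
  doubly used edges has large chromatic number, or one of its large independent sets carries only
  singly used edges.
\<close>

lemma biclique_system_of_directed_cover:
  fixes V :: "'v set" and A B :: "nat \<Rightarrow> 'v set"
  assumes V: "finite V" "V \<noteq> {}" and "X > 0" and "k > 0"
    and uniq: "\<And>u v i j. u \<in> V \<Longrightarrow> v \<in> V \<Longrightarrow> i < k \<Longrightarrow> j < k \<Longrightarrow>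
      u \<in> A i \<Longrightarrow> v \<in> B i \<Longrightarrow> u \<in> A j \<Longrightarrow> v \<in> B j \<Longrightarrow> i = j"
    and irrefl: "\<And>u i. u \<in> V \<Longrightarrow> i < k \<Longrightarrow> u \<in> A i \<Longrightarrow> u \<notin> B i"
    and small: "\<And>I. I \<subseteq> V \<Longrightarrow>
      (\<And>u v i. u \<in> I \<Longrightarrow> v \<in> I \<Longrightarrow> i < k \<Longrightarrow> u \<in> A i \<Longrightarrow> v \<notin> B i) \<Longrightarrow> card I * (X * X) \<le> card V"
  shows "\<exists>(W :: 'v set) (K :: (nat \<times> nat) set) A' B'. W \<noteq> {} \<and> K \<noteq> {} \<and> card K \<le> k * k \<and>
    biclique_system W K A' B' \<and> needs_colours W (system_arcs K A' B') X"
proof -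
  \<comment> \<open>These bicliques hold the edges covered by \<open>i\<close> in one direction and
    by \<open>j\<close> in the other; \<open>i < j\<close> ensures that each is listed once.\<close>
  define K2 where "K2 = {..<k} \<times> {..<k}"
  define A2 where "A2 = (\<lambda>(i, j). if i < j then V \<inter> A i \<inter> B j else {})"
  define B2 where "B2 = (\<lambda>(i, j). if i < j then V \<inter> B i \<inter> A j else {})"
  have sys2: "biclique_system V K2 A2 B2"
    unfolding biclique_system_def
  proof (intro conjI ballI impI)
    fix p q assume pq: "p \<in> K2" "q \<in> K2" "p \<noteq> q"
    obtain i j i' j' where ij: "p = (i, j)" "q = (i', j')" by (cases p; cases q)
    show "biarcs (A2 p) (B2 p) \<inter> biarcs (A2 q) (B2 q) = {}"
    proof (rule ccontr)
      assume "\<not> ?thesis"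
      then obtain u v where "(u, v) \<in> biarcs (A2 p) (B2 p)" "(u, v) \<in> biarcs (A2 q) (B2 q)"
        by auto
      then have lt: "i < j" "i' < j'" and V: "u \<in> V" "v \<in> V"
        and h: "(u \<in> A i \<and> u \<in> B j \<and> v \<in> B i \<and> v \<in> A j) \<or> (v \<in> A i \<and> v \<in> B j \<and> u \<in> B i \<and> u \<in> A j)"
          "(u \<in> A i' \<and> u \<in> B j' \<and> v \<in> B i' \<and> v \<in> A j') \<or> (v \<in> A i' \<and> v \<in> B j' \<and> u \<in> B i' \<and> u \<in> A j')"
        by (auto simp: ij biarcs_def A2_def B2_def split: if_splits)
      have k: "i < k" "j < k" "i' < k" "j' < k" using pq by (auto simp: ij K2_def)
      from h show False
      proof (elim disjE conjE, goal_cases)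
        case 1
        then have "i = i'" "j = j'" using uniq[OF V, of i i'] uniq[OF V(2,1), of j j'] k by simp_all
        then show ?case using pq by (simp add: ij)
      next
        case 2
        then have "i = j'" "j = i'" using uniq[OF V, of i j'] uniq[OF V(2,1), of j i'] k by simp_all
        then show ?case using lt by simp
      next
        case 3
        then have "j = i'" "i = j'" using uniq[OF V, of j i'] uniq[OF V(2,1), of i j'] k by simp_all
        then show ?case using lt by simp
      next
        case 4
        then have "j = j'" "i = i'" using uniq[OF V, of j j'] uniq[OF V(2,1), of i i'] k by simp_all
        then show ?case using pq by (simp add: ij)
      qed
    qed
  qed (use V irrefl in \<open>auto simp: K2_def A2_def B2_def split: if_splits\<close>)
  show ?thesis
  \<comment> \<open>The threshold \<open>card V / X\<close> splits the hypothesis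
    \<open>small\<close> evenly: inside a larger \<open>W\<close>, sets of size at most
    \<open>card V / (X * X)\<close> have size at most \<open>card W / X\<close>.\<close>
  proof (cases "\<exists>W \<subseteq> V. (\<forall>u\<in>W. \<forall>v\<in>W. (u, v) \<notin> system_arcs K2 A2 B2) \<and> card W * X > card V")
    case True
    then obtain W where W: "W \<subseteq> V" "card W * X > card V"
      and noarc: "\<And>u v. u \<in> W \<Longrightarrow> v \<in> W \<Longrightarrow> (u, v) \<notin> system_arcs K2 A2 B2"
      by blast
    have "finite W" using W V finite_subset by auto
    have "W \<noteq> {}" using W by auto
    \<comment> \<open>The zero component gives both cases the same index type.\<close>
    define K1 where "K1 = {..<k} \<times> {0 :: nat}"
    define A1 where "A1 = (\<lambda>(i, j :: nat). W \<inter> A i)"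
    define B1 where "B1 = (\<lambda>(i, j :: nat). W \<inter> B i)"
    have single: False
      if uv: "u \<in> W" "v \<in> W" "i < k" "j < k" "u \<in> A i" "v \<in> B i" "v \<in> A j" "u \<in> B j" for u v i j
    proof -
      have "u \<in> V" "v \<in> V" using uv W by auto
      then have "i \<noteq> j" using irrefl uv by metis
      then consider "i < j" | "j < i" by linarith
      then have "(u, v) \<in> system_arcs K2 A2 B2"
      proof cases
        case 1
        then have "(u, v) \<in> biarcs (A2 (i, j)) (B2 (i, j))"
          using uv \<open>u \<in> V\<close> \<open>v \<in> V\<close> by (auto simp: biarcs_def A2_def B2_def)
        then show ?thesis using uv unfolding system_arcs_def K2_def by blast
      next
        case 2
        then have "(u, v) \<in> biarcs (A2 (j, i)) (B2 (j, i))"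
          using uv \<open>u \<in> V\<close> \<open>v \<in> V\<close> by (auto simp: biarcs_def A2_def B2_def)
        then show ?thesis using uv unfolding system_arcs_def K2_def by blast
      qed
      then show False using noarc uv by blast
    qed
    have "biclique_system W K1 A1 B1"
      unfolding biclique_system_def
    proof (intro conjI ballI impI)
      fix p q assume pq: "p \<in> K1" "q \<in> K1" "p \<noteq> q"
      then obtain i j where ij: "p = (i, 0)" "q = (j, 0)" "i < k" "j < k" "i \<noteq> j"
        by (auto simp: K1_def)
      show "biarcs (A1 p) (B1 p) \<inter> biarcs (A1 q) (B1 q) = {}"
      proof (rule ccontr)
        assume "\<not> ?thesis"
        then obtain u v where "(u, v) \<in> biarcs (W \<inter> A i) (W \<inter> B i)" "(u, v) \<in> biarcs (W \<inter> A j) (W \<inter> B j)"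
          by (auto simp: ij A1_def B1_def)
        moreover from this have "u \<in> W" "v \<in> W" by (auto simp: biarcs_def)
        ultimately show False
          using uniq[of u v i j] uniq[of v u i j] single[of u v i j] single[of v u i j] ij W
          by (auto simp: biarcs_def)
      qed
    qed (use \<open>finite W\<close> irrefl W in \<open>auto simp: K1_def A1_def B1_def\<close>)
    moreover have "needs_colours W (system_arcs K1 A1 B1) X"
    proof (rule needs_colours_if_independent_small)
      fix I assume I: "I \<subseteq> W" and ind: "\<And>u v. u \<in> I \<Longrightarrow> v \<in> I \<Longrightarrow> (u, v) \<notin> system_arcs K1 A1 B1"
      have "card I * (X * X) \<le> card V"
      proof (rule small)
        fix u v i assume "u \<in> I" "v \<in> I" "i < k" "u \<in> A i"
        then have "(u, v) \<notin> biarcs (W \<inter> A i) (W \<inter> B i)"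
          using ind[of u v] by (force simp: system_arcs_def K1_def A1_def B1_def)
        then show "v \<notin> B i"
          using I \<open>u \<in> I\<close> \<open>v \<in> I\<close> \<open>u \<in> A i\<close> by (auto simp: biarcs_def)
      qed (use I W in auto)
      then have "card I * X * X \<le> card W * X"
        using W(2) unfolding mult.assoc by linarith
      then show "card I * X \<le> card W"
        using \<open>X > 0\<close> by simp
    qed (use \<open>finite W\<close> \<open>W \<noteq> {}\<close> in auto)
    moreover have "card K1 \<le> k * k" "K1 \<noteq> {}"
      using \<open>k > 0\<close> by (simp_all add: K1_def card_cartesian_product lessThan_empty_iff)
    ultimately show ?thesis
      using \<open>W \<noteq> {}\<close> by - (rule exI[of _ W], rule exI[of _ K1], rule exI[of _ A1], rule exI[of _ B1], intro conjI; assumption)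
  next
    case False
    have "needs_colours V (system_arcs K2 A2 B2) X"
    proof (rule needs_colours_if_independent_small[OF V])
      fix I assume "I \<subseteq> V" "\<And>u v. u \<in> I \<Longrightarrow> v \<in> I \<Longrightarrow> (u, v) \<notin> system_arcs K2 A2 B2"
      then have "\<not> card I * X > card V" using False by blast
      then show "card I * X \<le> card V" by simp
    qed
    moreover have "card K2 \<le> k * k" "K2 \<noteq> {}"
      using \<open>k > 0\<close> by (simp_all add: K2_def card_cartesian_product lessThan_empty_iff)
    ultimately show ?thesis
      using sys2 \<open>V \<noteq> {}\<close> by - (rule exI[of _ V], rule exI[of _ K2], rule exI[of _ A2], rule exI[of _ B2], intro conjI; assumption)
  qed
qed

section \<open>Degrees and regularisation\<close>

definition neighbours :: "('v \<times> 'v) set \<Rightarrow> 'v \<Rightarrow> 'v set" where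
  "neighbours E v = {u. (v, u) \<in> E}"

lemma card_neighbours_system:
  assumes "biclique_system W K A B"
  shows "card (neighbours (system_arcs K A B) v) =
    (\<Sum>i\<in>K. if v \<in> A i then card (B i) else if v \<in> B i then card (A i) else 0)"
proof -
  define N where "N = (\<lambda>i. if v \<in> A i then B i else if v \<in> B i then A i else {})"
  have disj: "A i \<inter> B i = {}" and sub: "A i \<subseteq> W" "B i \<subseteq> W" if "i \<in> K" for i
    using assms that by (auto simp: biclique_system_def)
  have N: "u \<in> N i \<longleftrightarrow> (v, u) \<in> biarcs (A i) (B i)" if "i \<in> K" for i u
    using disj[OF that] by (auto simp: N_def biarcs_def)
  have "neighbours (system_arcs K A B) v = (\<Union>i\<in>K. N i)"
    using N by (auto simp: neighbours_def system_arcs_def)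
  also have "card \<dots> = (\<Sum>i\<in>K. card (N i))"
  proof (rule card_UN_disjoint)
    show "finite K" using assms by (simp add: biclique_system_def)
    have "finite W" using assms by (simp add: biclique_system_def)
    then have "finite (A i)" "finite (B i)" if "i \<in> K" for i
      using sub[OF that] by (blast intro: finite_subset)+
    then show "\<forall>i\<in>K. finite (N i)"
      by (simp add: N_def)
    show "\<forall>i\<in>K. \<forall>j\<in>K. i \<noteq> j \<longrightarrow> N i \<inter> N j = {}"
    proof (intro ballI impI)
      fix i j assume "i \<in> K" "j \<in> K" "i \<noteq> j"
      then have "biarcs (A i) (B i) \<inter> biarcs (A j) (B j) = {}"
        using assms by (auto simp: biclique_system_def)
      then show "N i \<inter> N j = {}" using N \<open>i \<in> K\<close> \<open>j \<in> K\<close> by blast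
    qed
  qed
  also have "\<dots> = (\<Sum>i\<in>K. if v \<in> A i then card (B i) else if v \<in> B i then card (A i) else 0)"
    by (rule sum.cong) (auto simp: N_def)
  finally show ?thesis .
qed

text \<open>
  Regularisation. For every biclique \<open>i\<close> the sets \<open>A i\<close>, \<open>B i\<close> and the rest of \<open>W\<close> are each padded with
  dummies to size \<open>N = card W\<close>, and the padded rest is joined to \<open>N\<close> further dummies; this gives every
  vertex of \<open>W\<close> degree \<open>N\<close> from each \<open>i\<close> and every dummy degree \<open>N\<close>. There are three dummies \<open>(i, v, j)\<close>,
  \<open>j < 3\<close>, for each \<open>i\<close> and \<open>v \<in> W\<close>; joining, for each \<open>j\<close>, the dummies with this \<open>j\<close> to a new set of
  \<open>(card K - 1) * N\<close> vertices makes all degrees equal to \<open>card K * N\<close>.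
\<close>

lemma regular_biclique_system:
  fixes W :: "'v set" and K :: "'k set"
  assumes sys: "biclique_system W K A B" and "W \<noteq> {}" "K \<noteq> {}"
    and col: "needs_colours W (system_arcs K A B) X"
  shows "\<exists>(W' :: ('v + 'k \<times> 'v \<times> nat) set) (K' :: ('k \<times> bool + nat) set) A' B' d.
    biclique_system W' K' A' B' \<and> card K' = 2 * card K + 3 \<and>
    (\<forall>v\<in>W'. card (neighbours (system_arcs K' A' B') v) = d) \<and>
    needs_colours W' (system_arcs K' A' B') X"
proof -
  define s where "s = (\<lambda>i v. if v \<in> A i then 0 else if v \<in> B i then 1 else 2 :: nat)"
  have s3: "s i v < 3" for i v by (simp add: s_def)
  \<comment> \<open>The residue is 0 for the class cyclically after that of \<open>v\<close>, 1 for
    the one after that; the value 2, belonging to the class of \<open>v\<close> itself, is left to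
    \<open>C i\<close>. Hence each of the three dummies of \<open>(i, v)\<close> lies in exactly one
    of \<open>P i 0\<close>, \<open>P i 1\<close>, \<open>P i 2\<close>, \<open>C i\<close>. As
    \<open>s i v \<le> 2\<close>, the subtraction is never truncated.\<close>
  define pad where "pad = (\<lambda>i \<sigma> v. if s i v = \<sigma> then Inl v else Inr (i, v, (\<sigma> + 2 - s i v) mod 3) :: 'v + 'k \<times> 'v \<times> nat)"
  define P where "P = (\<lambda>i \<sigma>. pad i \<sigma> ` W)"
  define C where "C = (\<lambda>i. (\<lambda>v. Inr (i, v, 2) :: 'v + 'k \<times> 'v \<times> nat) ` W)"
  obtain i0 where "i0 \<in> K" using \<open>K \<noteq> {}\<close> by blast
  define D where "D = (\<lambda>j. (\<lambda>(i, v). Inr (i, v, j) :: 'v + 'k \<times> 'v \<times> nat) ` (K \<times> W))"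
  \<comment> \<open>Omitting one index \<open>i0\<close> yields the count
    \<open>(card K - 1) * N\<close>; the tags \<open>j + 3\<close> keep these vertices apart from
    the dummies.\<close>
  define E where "E = (\<lambda>j. (\<lambda>(i, v). Inr (i, v, j + 3) :: 'v + 'k \<times> 'v \<times> nat) ` ((K - {i0}) \<times> W))"
  define A' where "A' = case_sum (\<lambda>(i, b). if b then P i 2 else P i 0) D"
  define B' where "B' = case_sum (\<lambda>(i, b). if b then C i else P i 1) E"
  have AB': "A' (Inl (i, False)) = P i 0" "A' (Inl (i, True)) = P i 2" "A' (Inr j) = D j"
    "B' (Inl (i, False)) = P i 1" "B' (Inl (i, True)) = C i" "B' (Inr j) = E j" for i j
    by (simp_all add: A'_def B'_def)
  define K' where "K' = (K \<times> (UNIV :: bool set)) <+> {..<3 :: nat}"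
  define W' where "W' = Inl ` W \<union> (\<Union>j<3. D j \<union> E j)"
  have fin: "finite W" "finite K" and disj: "\<And>i. i \<in> K \<Longrightarrow> A i \<inter> B i = {}"
    and sub: "\<And>i. i \<in> K \<Longrightarrow> A i \<subseteq> W" "\<And>i. i \<in> K \<Longrightarrow> B i \<subseteq> W"
    and arcs_disj: "\<And>i j. i \<in> K \<Longrightarrow> j \<in> K \<Longrightarrow> i \<noteq> j \<Longrightarrow> biarcs (A i) (B i) \<inter> biarcs (A j) (B j) = {}"
    using sys by (auto simp: biclique_system_def)
  define N where "N = card W"
  have "N > 0" using fin \<open>W \<noteq> {}\<close> by (simp add: N_def card_gt_0_iff)
  have "card K > 0" using fin \<open>K \<noteq> {}\<close> by (simp add: card_gt_0_iff)
  have Inl_P: "Inl v \<in> P i \<sigma> \<longleftrightarrow> v \<in> W \<and> s i v = \<sigma>" for v i \<sigma>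
    by (auto simp: P_def pad_def)
  have Inr_P: "Inr (i', v, j) \<in> P i \<sigma> \<longleftrightarrow> i' = i \<and> v \<in> W \<and> s i v \<noteq> \<sigma> \<and> j = (\<sigma> + 2 - s i v) mod 3" for i' v j i \<sigma>
    by (auto simp: P_def pad_def)
  have Inl_CDE: "Inl v \<notin> C i" "Inl v \<notin> D j" "Inl v \<notin> E j" for v i j
    by (auto simp: C_def D_def E_def)
  have Inr_C: "Inr (i', v, j) \<in> C i \<longleftrightarrow> i' = i \<and> v \<in> W \<and> j = 2" for i' v j i
    by (auto simp: C_def)
  have Inr_D: "Inr (i', v, j') \<in> D j \<longleftrightarrow> i' \<in> K \<and> v \<in> W \<and> j' = j" for i' v j' j
    by (auto simp: D_def)
  have Inr_E: "Inr (i', v, j') \<in> E j \<longleftrightarrow> i' \<in> K \<and> i' \<noteq> i0 \<and> v \<in> W \<and> j' = j + 3" for i' v j' j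
    by (auto simp: E_def)
  note mem = Inl_P Inr_P Inl_CDE Inr_C Inr_D Inr_E
  have cards: "card (P i \<sigma>) = N" "card (C i) = N" "card (D j) = card K * N" "card (E j) = (card K - 1) * N" for i \<sigma> j
  proof -
    have "inj_on (pad i \<sigma>) W" by (rule inj_onI) (auto simp: pad_def split: if_splits)
    then show "card (P i \<sigma>) = N" by (simp add: P_def N_def card_image)
    show "card (C i) = N" by (simp add: C_def N_def card_image inj_on_def)
    show "card (D j) = card K * N"
      unfolding D_def by (subst card_image) (auto simp: inj_on_def card_cartesian_product N_def)
    show "card (E j) = (card K - 1) * N"
      unfolding E_def using fin \<open>i0 \<in> K\<close>
      by (subst card_image) (auto simp: inj_on_def card_cartesian_product N_def)
  qed
  have sA: "s i v = 0 \<longleftrightarrow> v \<in> A i" and sB: "i \<in> K \<Longrightarrow> s i v = 1 \<longleftrightarrow> v \<in> B i" for i v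
    using disj by (auto simp: s_def)
  have mod_lt: "(\<sigma> + 2 - s i v) mod 3 < 3" for \<sigma> i v by simp
  have mod_ne: "(\<sigma> + 2 - s i v) mod 3 \<noteq> 2" if "s i v \<noteq> \<sigma>" "\<sigma> < 3" for \<sigma> i v
  proof -
    have "\<sigma> \<in> {0, 1, 2}" "s i v \<in> {0, 1, 2}" using that s3[of i v] by auto
    then show ?thesis using that(1) by auto
  qed
  have mod_inj: "\<sigma> = \<tau>" if "(\<sigma> + 2 - s i v) mod 3 = (\<tau> + 2 - s i v) mod 3" "\<sigma> < 3" "\<tau> < 3" for \<sigma> \<tau> i v
  proof -
    have "\<sigma> \<in> {0, 1, 2}" "\<tau> \<in> {0, 1, 2}" "s i v \<in> {0, 1, 2}" using that s3[of i v] by auto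
    then show ?thesis using that(1) by auto
  qed
  have P_disj: "x \<notin> P i \<tau>" if "x \<in> P i \<sigma>" "\<sigma> \<noteq> \<tau>" "\<sigma> < 3" "\<tau> < 3" for x i \<sigma> \<tau>
  proof (cases x)
    case (Inr t)
    obtain i' v j where "t = (i', v, j)" by (cases t)
    then show ?thesis
      using that(1) mod_inj[OF _ that(3,4), of i v] that(2) by (simp add: Inr Inr_P) metis
  qed (use that in \<open>simp add: Inl_P\<close>)
  have PC_disj: "x \<notin> C i'" if "x \<in> P i \<sigma>" "\<sigma> < 3" for x i i' \<sigma>
    using that mod_ne[of i _ \<sigma>] by (cases x) (auto simp: Inl_CDE Inr_P Inr_C)
  have P_Inl: "\<exists>v. x = Inl v" if "x \<in> P i \<sigma>" "x \<in> P i' \<tau>" "i \<noteq> i'" for x i i' \<sigma> \<tau>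
    using that by (cases x) (auto simp: Inr_P)
  have PE_disj: "x \<notin> E j" if "x \<in> P i \<sigma>" for x i \<sigma> j
    using that mod_lt[of \<sigma> i] by (cases x) (auto simp: Inl_CDE Inr_P Inr_E not_less[symmetric])
  have CE_disj: "x \<notin> E j" if "x \<in> C i" for x i j
    using that by (auto simp: C_def E_def)
  have DE_disj: "x \<notin> E j'" if "x \<in> D j" "j < 3" for x j j'
    using that by (auto simp: D_def E_def)
  have subW': "A' p \<subseteq> W'" "B' p \<subseteq> W'" if "p \<in> K'" for p
  proof -
    have dummy: "Inr (i, v, j) \<in> W'" if "i \<in> K" "v \<in> W" "j < 3" for i v j
      using that Inr_D[of i v j j] unfolding W'_def by blast
    have P: "P i \<sigma> \<subseteq> W'" if "i \<in> K" for i \<sigma>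
      using dummy[OF that _ mod_lt] by (auto simp: P_def pad_def) (simp add: W'_def)
    have C: "C i \<subseteq> W'" if "i \<in> K" for i
      using dummy[OF that] by (auto simp: C_def)
    have DE: "D j \<subseteq> W'" "E j \<subseteq> W'" if "j < 3" for j
      using that by (auto simp: W'_def)
    show "A' p \<subseteq> W'" "B' p \<subseteq> W'"
    proof (atomize (full), cases p)
      case (Inl ib)
      obtain i b where "ib = (i, b)" by (cases ib)
      then show "A' p \<subseteq> W' \<and> B' p \<subseteq> W'"
        using that P[of i] C[of i] Inl by (cases b) (simp_all add: AB' K'_def Plus_def image_iff)
    next
      case (Inr j)
      then show "A' p \<subseteq> W' \<and> B' p \<subseteq> W'"
        using that DE[of j] by (auto simp: AB' K'_def)
    qed
  qed
  have sys': "biclique_system W' K' A' B'"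
    unfolding biclique_system_def
  proof (intro conjI ballI impI)
    show "finite W'" "finite K'"
      using fin by (auto simp: W'_def K'_def D_def E_def)
    show "A' p \<inter> B' p = {}" if "p \<in> K'" for p
    proof (cases p)
      case (Inl ib)
      then show ?thesis
        using P_disj[of _ _ 0 1] PC_disj[of _ _ 2] by (cases ib) (auto simp: A'_def B'_def)
    next
      case (Inr j)
      then show ?thesis
        using that DE_disj by (auto simp: A'_def B'_def K'_def)
    qed
    \<comment> \<open>Every arc of \<open>q\<close> has an end in \<open>B' q\<close>, so it is
      enough that this side avoids both sides of \<open>p\<close>.\<close>
    have sep: "biarcs (A' p) (B' p) \<inter> biarcs (A' q) (B' q) = {}"
      if "\<And>x. x \<in> B' q \<Longrightarrow> x \<notin> A' p \<and> x \<notin> B' p" for p q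
      using that by (auto simp: biarcs_def)
    fix p q assume pq: "p \<in> K'" "q \<in> K'" "p \<noteq> q"
    show "biarcs (A' p) (B' p) \<inter> biarcs (A' q) (B' q) = {}"
    proof (cases p; cases q)
      fix ib jc assume p: "p = Inl ib" and q: "q = Inl jc"
      obtain i b j c where ib: "ib = (i, b)" "jc = (j, c)" by (cases ib; cases jc)
      have K: "i \<in> K" "j \<in> K" using pq by (auto simp: p q ib K'_def)
      show ?thesis
      proof (cases "b \<or> c")
        case True
        then consider "c" "\<not> b" | "b" "\<not> c" | "b" "c" by blast
        then show ?thesis
        proof cases
          case 1
          then show ?thesis
            using PC_disj[of _ _ 0] PC_disj[of _ _ 1] by (intro sep) (auto simp: p q ib A'_def B'_def)
        next
          case 2
          then show ?thesis
            using PC_disj[of _ _ 0] PC_disj[of _ _ 1]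
            by (subst Int_commute, intro sep) (auto simp: p q ib A'_def B'_def)
        next
          case 3
          then have "i \<noteq> j" using pq by (auto simp: p q ib)
          then show ?thesis
            using 3 PC_disj[of _ _ 2] by (intro sep) (auto simp: p q ib A'_def B'_def C_def)
        qed
      next
        case False
        then have "i \<noteq> j" using pq by (auto simp: p q ib)
        \<comment> \<open>Dummies carry their index, so for \<open>i \<noteq> j\<close> a common arc
          joins original vertices and would already be common in the given system.\<close>
        show ?thesis
        proof (rule ccontr)
          assume "\<not> ?thesis"
          then obtain x y where xy: "(x, y) \<in> biarcs (P i 0) (P i 1)" "(x, y) \<in> biarcs (P j 0) (P j 1)"
            using False by (auto simp: p q ib A'_def B'_def)
          then obtain u v where "x = Inl u" "y = Inl v"
            using P_Inl[OF _ _ \<open>i \<noteq> j\<close>] by (fastforce simp: biarcs_def)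
          then have "(u, v) \<in> biarcs (A i) (B i) \<inter> biarcs (A j) (B j)"
            using xy K by (auto simp: biarcs_def Inl_P sA sB simp del: One_nat_def)
          then show False using arcs_disj[OF K \<open>i \<noteq> j\<close>] by blast
        qed
      qed
    next
      fix ib j assume p: "p = Inl ib" and q: "q = Inr j"
      show ?thesis
        using PE_disj CE_disj by (intro sep) (auto simp: p q A'_def B'_def split: prod.splits if_splits)
    next
      fix ib j assume q: "q = Inl ib" and p: "p = Inr j"
      show ?thesis
        using PE_disj CE_disj
        by (subst Int_commute, intro sep) (auto simp: p q A'_def B'_def split: prod.splits if_splits)
    next
      fix j j' assume p: "p = Inr j" and q: "q = Inr j'"
      then have "j \<noteq> j'" "j < 3" using pq by (auto simp: K'_def)
      then show ?thesis
        using DE_disj by (intro sep) (auto simp: p q A'_def B'_def E_def D_def)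
    qed
  qed (use subW' in auto)
  have "card (neighbours (system_arcs K' A' B') x) = card K * N" if x: "x \<in> W'" for x
  proof -
    define f where "f = (\<lambda>p. if x \<in> A' p then card (B' p) else if x \<in> B' p then card (A' p) else 0)"
    have "card (neighbours (system_arcs K' A' B') x) = (\<Sum>p\<in>K'. f p)"
      unfolding card_neighbours_system[OF sys'] f_def ..
    also have "\<dots> = (\<Sum>ib\<in>K \<times> UNIV. f (Inl ib)) + (\<Sum>j<3. f (Inr j))"
      unfolding K'_def using fin by (subst sum.Plus) (auto simp: o_def)
    also have "(\<Sum>ib\<in>K \<times> UNIV. f (Inl ib)) = (\<Sum>i\<in>K. f (Inl (i, False)) + f (Inl (i, True)))"
    proof -
      have "(\<Sum>ib\<in>K \<times> UNIV. f (Inl ib)) = (\<Sum>i\<in>K. \<Sum>b\<in>UNIV. f (Inl (i, b)))"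
        by (simp add: sum.cartesian_product)
      then show ?thesis by (simp add: UNIV_bool)
    qed
    finally have deg: "card (neighbours (system_arcs K' A' B') x) =
      (\<Sum>i\<in>K. f (Inl (i, False)) + f (Inl (i, True))) + (\<Sum>j<3. f (Inr j))" .
    have f1: "f (Inl (i, False)) + f (Inl (i, True)) = (if x \<in> P i 0 \<union> P i 1 \<union> P i 2 \<union> C i then N else 0)" for i
      using P_disj[of x i 0 1] P_disj[of x i 0 2] P_disj[of x i 1 2] PC_disj[of x i 0 i] PC_disj[of x i 1 i]
      by (auto simp: f_def A'_def B'_def cards)
    have f2: "f (Inr j) = (if x \<in> D j then (card K - 1) * N else if x \<in> E j then card K * N else 0)" for j
      by (auto simp: f_def A'_def B'_def cards)
    show ?thesis
    proof (cases x)
      case (Inl v)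
      then have "v \<in> W" using x by (auto simp: W'_def D_def E_def)
      have "x \<in> P i 0 \<union> P i 1 \<union> P i 2" for i
        using s3[of i v] \<open>v \<in> W\<close> by (auto simp: Inl Inl_P)
      then show ?thesis
        unfolding deg f1 f2 by (simp add: Inl Inl_CDE)
    next
      case (Inr t)
      obtain i v j where t: "t = (i, v, j)" by (cases t)
      show ?thesis
      proof (cases "j < 3")
        case True
        then have iv: "i \<in> K" "v \<in> W" using x by (auto simp: W'_def Inr t mem)
        have "x \<in> P i 0 \<union> P i 1 \<union> P i 2 \<union> C i"
        proof -
          have "s i v \<in> {0, 1, 2}" "j \<in> {0, 1, 2}" using s3[of i v] True by auto
          then show ?thesis using iv by (auto simp: Inr t mem)
        qed
        then have "x \<in> P i' 0 \<union> P i' 1 \<union> P i' 2 \<union> C i' \<longleftrightarrow> i' = i" for i'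
          by (auto simp: Inr t mem)
        then have "(\<Sum>i'\<in>K. f (Inl (i', False)) + f (Inl (i', True))) = N"
          unfolding f1 using iv fin by simp
        moreover have "(\<Sum>j'<3. f (Inr j')) = (\<Sum>j'<3. if j' = j then (card K - 1) * N else 0)"
          unfolding f2 using iv True by (intro sum.cong) (auto simp: Inr t mem)
        moreover have "N + (card K - 1) * N = card K * N"
          using \<open>card K > 0\<close> by (cases "card K") auto
        ultimately show ?thesis
          unfolding deg using True by simp
      next
        case False
        then obtain j0 where j0: "j = j0 + 3" using le_Suc_ex by (metis add.commute not_less)
        have iv: "i \<in> K" "i \<noteq> i0" "v \<in> W" "j0 < 3" using x False by (auto simp: W'_def Inr t mem j0)
        have "x \<notin> P i' 0 \<union> P i' 1 \<union> P i' 2 \<union> C i'" for i'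
          using mod_lt False by (auto simp: Inr t mem)
        then have "(\<Sum>i'\<in>K. f (Inl (i', False)) + f (Inl (i', True))) = 0"
          unfolding f1 by simp
        moreover have "(\<Sum>j'<3. f (Inr j')) = (\<Sum>j'<3. if j' = j0 then card K * N else 0)"
          unfolding f2 using iv False by (intro sum.cong) (auto simp: Inr t mem j0)
        ultimately show ?thesis
          unfolding deg using iv by simp
      qed
    qed
  qed
  moreover have "card K' = 2 * card K + 3"
    unfolding K'_def using fin by (simp add: card_Plus card_cartesian_product)
  moreover have "needs_colours W' (system_arcs K' A' B') X"
    unfolding needs_colours_def
  proof (intro allI impI)
    fix c :: "'v + 'k \<times> 'v \<times> nat \<Rightarrow> nat" and M
    assume c: "\<forall>v\<in>W'. c v < M" "\<forall>(u, v)\<in>system_arcs K' A' B'. c u \<noteq> c v"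
    have "(Inl u, Inl v) \<in> system_arcs K' A' B'" if uv: "(u, v) \<in> system_arcs K A B" for u v
    proof -
      obtain i where i: "i \<in> K" "(u, v) \<in> biarcs (A i) (B i)"
        using uv by (auto simp: system_arcs_def)
      then have "u \<in> W" "v \<in> W" using sub by (auto simp: biarcs_def)
      then have "(Inl u, Inl v) \<in> biarcs (A' (Inl (i, False))) (B' (Inl (i, False)))"
        using i \<open>u \<in> W\<close> \<open>v \<in> W\<close> by (auto simp: biarcs_def AB' Inl_P sA sB simp del: One_nat_def)
      moreover have "Inl (i, False) \<in> K'" using i by (auto simp: K'_def)
      ultimately show ?thesis unfolding system_arcs_def by blast
    qed
    then have "\<forall>(u, v)\<in>system_arcs K A B. (c \<circ> Inl) u \<noteq> (c \<circ> Inl) v"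
      using c(2) by fastforce
    moreover have "\<forall>v\<in>W. (c \<circ> Inl) v < M"
      using c(1) by (simp add: W'_def)
    ultimately show "X \<le> M"
      using col unfolding needs_colours_def by blast
  qed
  ultimately show ?thesis
    using sys'
    by - (rule exI[of _ W'], rule exI[of _ K'], rule exI[of _ A'], rule exI[of _ B'], rule exI[of _ "card K * N"], intro conjI ballI; assumption?; blast)
qed

section \<open>From systems of bicliques to graphs\<close>

lemma biclique_with_proj_iff:
  "biclique H \<longleftrightarrow> finite (pverts H) \<and> (\<exists>S T. S \<noteq> {} \<and> T \<noteq> {} \<and> S \<inter> T = {} \<and>
     pverts H = S \<union> T \<and> parcs H = biarcs S T)"
proof
  assume "biclique H"
  then obtain S T where "finite (pverts H)" "pverts H = S \<union> T" "S \<inter> T = {}" "card S > 0" "card T > 0"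
    "parcs H = S \<times> T \<union> T \<times> S"
    unfolding biclique_def complete_bipartite_digraph_pair_def by blast
  then show "finite (pverts H) \<and> (\<exists>S T. S \<noteq> {} \<and> T \<noteq> {} \<and> S \<inter> T = {} \<and>
     pverts H = S \<union> T \<and> parcs H = biarcs S T)"
    unfolding biarcs_def by (metis card.empty less_irrefl)
next
  assume "finite (pverts H) \<and> (\<exists>S T. S \<noteq> {} \<and> T \<noteq> {} \<and> S \<inter> T = {} \<and>
     pverts H = S \<union> T \<and> parcs H = biarcs S T)"
  then obtain S T where H: "finite (pverts H)" "S \<noteq> {}" "T \<noteq> {}" "S \<inter> T = {}"
     "pverts H = S \<union> T" "parcs H = S \<times> T \<union> T \<times> S"
    unfolding biarcs_def by blast
  then have "card S > 0" "card T > 0" by (auto simp: card_gt_0_iff)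
  moreover have "complete_bipartite_digraph (card S) (card T) (with_proj H)"
    unfolding complete_bipartite_digraph_pair_def using H by blast
  ultimately show "biclique H" unfolding biclique_def by blast
qed

text \<open>Colour a vertex by the set of bicliques that have it on a chosen side. The bound forces
  \<open>bp\<close> to grow, which yields infinitely many values of \<open>k\<close>.\<close>

lemma chromatic_number_le_two_power_bp:
  fixes G :: "'a pair_pre_digraph"
  assumes "pair_graph G"
  shows "chromatic_number G \<le> 2 ^ bp G"
proof -
  obtain P where P: "biclique_partition G P" "card P = bp G"
    using bp_attained[OF assms] by blast
  have "finite P" using P by (simp add: biclique_partition_def)
  have "\<exists>S. \<forall>u v. (u, v) \<in> parcs H \<longrightarrow> (u \<in> S) \<noteq> (v \<in> S)" if "H \<in> P" for H
  proof -
    have "biclique H" using P(1) that by (simp add: biclique_partition_def)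
    then obtain S T where "S \<inter> T = {}" "parcs H = biarcs S T"
      unfolding biclique_with_proj_iff by blast
    then have "\<forall>u v. (u, v) \<in> parcs H \<longrightarrow> (u \<in> S) \<noteq> (v \<in> S)"
      by (auto simp: biarcs_def)
    then show ?thesis ..
  qed
  then obtain S where S: "\<And>H u v. H \<in> P \<Longrightarrow> (u, v) \<in> parcs H \<Longrightarrow> (u \<in> S H) \<noteq> (v \<in> S H)"
    by metis
  define f where "f = (\<lambda>v. {H \<in> P. v \<in> S H})"
  obtain h where h: "bij_betw h (Pow P) {0..<card (Pow P)}"
    using ex_bij_betw_finite_nat[of "Pow P"] \<open>finite P\<close> by auto
  have fP: "f v \<in> Pow P" for v by (auto simp: f_def)
  have "proper_coloring G (2 ^ bp G) (h \<circ> f)"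
    unfolding proper_coloring_def
  proof (intro conjI ballI, goal_cases)
    case (1 v)
    then show ?case
      using bij_betwE[OF h] fP[of v] P(2) \<open>finite P\<close> by (auto simp: card_Pow)
  next
    case (2 e)
    obtain u v where e: "e = (u, v)" by (cases e)
    have "(u, v) \<in> (\<Union>H\<in>P. parcs H)"
      using 2 P(1) by (simp add: e biclique_partition_def)
    then obtain H where "H \<in> P" "(u, v) \<in> parcs H" by blast
    then have "f u \<noteq> f v" using S[of H u v] by (auto simp: f_def)
    then have "h (f u) \<noteq> h (f v)"
      using inj_onD[OF bij_betw_imp_inj_on[OF h] _ fP fP] by blast
    then show ?case by (simp add: e)
  qed
  then show ?thesis
    unfolding chromatic_number_def by (intro Least_le exI)
qed

lemma pair_graph_of_biclique_system:
  fixes W :: "'v set" and K :: "'k set"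
  assumes sys: "biclique_system W K A B"
    and reg: "\<And>v. v \<in> W \<Longrightarrow> card (neighbours (system_arcs K A B) v) = d"
    and col: "needs_colours W (system_arcs K A B) X"
  shows "\<exists>G :: nat pair_pre_digraph. pair_graph G \<and> regular_graph G \<and>
    bp G \<le> card K \<and> X \<le> chromatic_number G"
proof -
  let ?E = "system_arcs K A B"
  have fin: "finite W" "finite K" and disj: "\<And>i. i \<in> K \<Longrightarrow> A i \<inter> B i = {}"
    and sub: "\<And>i. i \<in> K \<Longrightarrow> A i \<subseteq> W" "\<And>i. i \<in> K \<Longrightarrow> B i \<subseteq> W"
    and arcs_disj: "\<And>i j. i \<in> K \<Longrightarrow> j \<in> K \<Longrightarrow> i \<noteq> j \<Longrightarrow> biarcs (A i) (B i) \<inter> biarcs (A j) (B j) = {}"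
    using sys by (auto simp: biclique_system_def)
  obtain f :: "'v \<Rightarrow> nat" where f: "inj_on f W"
    using finite_imp_inj_to_nat_seg[OF \<open>finite W\<close>] by blast
  let ?f = "map_prod f f"
  have E: "u \<in> W" "v \<in> W" "u \<noteq> v" "(v, u) \<in> ?E" if "(u, v) \<in> ?E" for u v
    using that sub disj by (auto simp: system_arcs_def biarcs_def) blast+
  define G where "G = \<lparr> pverts = f ` W, parcs = ?f ` ?E \<rparr>"
  have EW: "?E \<subseteq> W \<times> W" using E by auto
  have inj: "inj_on ?f (W \<times> W)"
    using f by (auto simp: inj_on_def)
  interpret G: pair_graph G
  proof unfold_locales
    show "finite (parcs G)"
      using finite_subset[OF EW] fin by (simp add: G_def)
    have "sym (parcs G)"
      using E(4) by (force simp: sym_def G_def)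
    then show "symmetric (with_proj G)"
      by (simp add: symmetric_def)
    show "fst e \<in> pverts G" "snd e \<in> pverts G" "fst e \<noteq> snd e" if "e \<in> parcs G" for e
    proof -
      obtain u v where "(u, v) \<in> ?E" "e = (f u, f v)" using \<open>e \<in> parcs G\<close> by (auto simp: G_def)
      then show "fst e \<in> pverts G" "snd e \<in> pverts G" "fst e \<noteq> snd e"
        using E(1-3)[of u v] f by (auto simp: G_def inj_on_eq_iff)
    qed
  qed (use fin in \<open>simp add: G_def\<close>)
  have "regular_graph G"
    unfolding regular_graph_def
  proof (intro exI ballI)
    fix x assume "x \<in> pverts G"
    then obtain v where v: "v \<in> W" "x = f v" by (auto simp: G_def)
    have "out_arcs (with_proj G) x = (\<lambda>u. (f v, f u)) ` neighbours ?E v"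
    proof (intro equalityI subsetI)
      fix e assume "e \<in> out_arcs (with_proj G) x"
      then obtain u' u where "(u', u) \<in> ?E" "e = (f u', f u)" "f u' = f v"
        by (auto simp: out_arcs_def G_def v)
      moreover from this have "u' = v" using E(1) v(1) f by (metis inj_onD)
      ultimately show "e \<in> (\<lambda>u. (f v, f u)) ` neighbours ?E v"
        by (auto simp: neighbours_def)
    qed (auto simp: out_arcs_def G_def neighbours_def v)
    moreover have "inj_on (\<lambda>u. (f v, f u)) (neighbours ?E v)"
      using E(2) by (intro inj_onI) (auto simp: neighbours_def intro: inj_onD[OF f])
    ultimately show "out_degree (with_proj G) x = d"
      unfolding out_degree_def using reg[OF v(1)] by (simp add: card_image)
  qed
  moreover have "bp G \<le> card K"
  proof -
    \<comment> \<open>The definition of a biclique demands nonempty sides; the members dropped here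
      have no arcs.\<close>
    define K' where "K' = {i \<in> K. A i \<noteq> {} \<and> B i \<noteq> {}}"
    define H where "H = (\<lambda>i. \<lparr> pverts = f ` (A i \<union> B i), parcs = biarcs (f ` A i) (f ` B i) \<rparr>)"
    have Harcs: "parcs (H i) = ?f ` biarcs (A i) (B i)" for i
      by (force simp: H_def biarcs_def)
    have arcsW: "biarcs (A i) (B i) \<subseteq> W \<times> W" if "i \<in> K" for i
      using sub[OF that] by (auto simp: biarcs_def)
    have "biclique_partition G (H ` K')"
      unfolding biclique_partition_def
    proof (intro conjI ballI impI)
      show "finite (H ` K')" using fin by (simp add: K'_def)
    next
      fix h assume "h \<in> H ` K'"
      then obtain i where i: "i \<in> K" "A i \<noteq> {}" "B i \<noteq> {}" "h = H i" by (auto simp: K'_def)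
      interpret H: pair_wf_digraph "H i"
        by unfold_locales (auto simp: H_def biarcs_def)
      have "parcs (H i) \<subseteq> parcs G"
        using i unfolding Harcs by (auto simp: G_def system_arcs_def)
      moreover have "pverts (H i) \<subseteq> pverts G"
        using sub[OF i(1)] by (auto simp: H_def G_def)
      ultimately show "subgraph (with_proj h) (with_proj G)"
        using G.wf_digraph H.wf_digraph by (simp add: subgraph_def compatible_def i)
      have "f ` A i \<inter> f ` B i = {}"
        using disj[OF i(1)] sub[OF i(1)] inj_onD[OF f] by blast
      moreover have "finite (A i)" "finite (B i)"
        using sub[OF i(1)] fin by (blast intro: finite_subset)+
      ultimately show "biclique h"
        unfolding biclique_with_proj_iff using i
        by (intro conjI exI[of _ "f ` A i"] exI[of _ "f ` B i"]) (auto simp: H_def)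
    next
      fix h h' assume "h \<in> H ` K'" "h' \<in> H ` K'" "h \<noteq> h'"
      then obtain i j where ij: "i \<in> K" "j \<in> K" "i \<noteq> j" "h = H i" "h' = H j" by (auto simp: K'_def)
      show "parcs h \<inter> parcs h' = {}"
        unfolding ij(4,5) Harcs inj_on_image_Int[OF inj arcsW[OF ij(1)] arcsW[OF ij(2)], symmetric]
        using arcs_disj[OF ij(1-3)] by simp
    next
      have "?E = (\<Union>i\<in>K'. biarcs (A i) (B i))"
        by (auto simp: system_arcs_def K'_def biarcs_def)
      then show "(\<Union>h\<in>H ` K'. parcs h) = parcs G"
        unfolding image_Union G_def by (simp add: Harcs image_UN)
    qed
    then have "bp G \<le> card (H ` K')"
      unfolding bp_def by (intro Least_le) blast
    also have "\<dots> \<le> card K'" using fin by (intro card_image_le) (simp add: K'_def)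
    also have "\<dots> \<le> card K" using fin by (intro card_mono) (auto simp: K'_def)
    finally show ?thesis .
  qed
  moreover have "X \<le> chromatic_number G"
  proof -
    obtain c where "proper_coloring G (chromatic_number G) c"
      using chromatic_number_attained[OF G.pair_graph] by blast
    then have "\<forall>v\<in>W. (c \<circ> f) v < chromatic_number G" "\<forall>(u, v)\<in>?E. (c \<circ> f) u \<noteq> (c \<circ> f) v"
      by (auto simp: proper_coloring_def G_def)
    then show ?thesis
      using col unfolding needs_colours_def by blast
  qed
  ultimately show ?thesis using G.pair_graph by blast
qed

section \<open>Certificates\<close>

text \<open>Non-vertical lines of the affine plane over the integers mod \<open>p\<close>. Without
  the vertical ones, lines and points have the same index set.\<close>

definition line :: "nat \<Rightarrow> nat \<times> nat \<Rightarrow> (nat \<times> nat) set" where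
  "line p = (\<lambda>(a, b). (\<lambda>x. (x, (a * x + b) mod p)) ` {..<p})"

lemma mem_line: "u \<in> line p (a, b) \<longleftrightarrow> fst u < p \<and> snd u = (a * fst u + b) mod p"
  by (cases u) (auto simp: line_def)

lemma card_line: "card (line p t) = p"
  by (cases t) (simp add: line_def card_image inj_on_def)

lemma line_subset: "line p t \<subseteq> {..<p} \<times> {..<p}"
  by (cases t) (auto simp: line_def)

lemma finite_line: "finite (line p t)"
  by (cases t) (simp add: line_def)

text \<open>Two common points with abscissas \<open>x\<close>, \<open>y\<close> make
  \<open>p\<close> divide \<open>(a - a') * (x - y)\<close>, and equal slopes would make the lines
  equal.\<close>

lemma line_inter:
  assumes "prime p" and "t \<in> {..<p} \<times> {..<p}" "t' \<in> {..<p} \<times> {..<p}" and "t \<noteq> t'"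
  shows "card (line p t \<inter> line p t') \<le> 1"
proof -
  obtain a b a' b' where t: "t = (a, b)" "t' = (a', b')" by (cases t; cases t')
  have lt: "a < p" "b < p" "a' < p" "b' < p" using assms by (auto simp: t)
  have eqI: "x = y" if "int p dvd int x - int y" "x < p" "y < p" for x y
    using that cong_int_iff[of x y p] cong_less_modulus_unique_nat[of x y p]
    unfolding cong_iff_dvd_diff by simp
  have "u = v" if u: "u \<in> line p t \<inter> line p t'" and v: "v \<in> line p t \<inter> line p t'" for u v
  proof -
    define x y where "x = fst u" and "y = fst v"
    have x: "x < p" "snd u = (a * x + b) mod p" "(a * x + b) mod p = (a' * x + b') mod p"
      using u by (auto simp: t mem_line x_def)
    have y: "y < p" "snd v = (a * y + b) mod p" "(a * y + b) mod p = (a' * y + b') mod p"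
      using v by (auto simp: t mem_line y_def)
    have cx: "[int a * int x + int b = int a' * int x + int b'] (mod int p)"
      using cong_int_iff[of "a * x + b" "a' * x + b'" p] x(3) by (simp add: cong_def)
    have cy: "[int a * int y + int b = int a' * int y + int b'] (mod int p)"
      using cong_int_iff[of "a * y + b" "a' * y + b'" p] y(3) by (simp add: cong_def)
    have "int p dvd (int a - int a') * (int x - int y)"
      using cong_diff[OF cx cy] unfolding cong_iff_dvd_diff by (simp add: algebra_simps)
    then have "int p dvd int a - int a' \<or> int p dvd int x - int y"
      using \<open>prime p\<close> by (simp add: prime_dvd_mult_iff)
    then have "x = y"
    proof
      assume "int p dvd int a - int a'"
      then have "a = a'" using eqI lt by blast
      then have "[b = b'] (mod p)"
        using x(3) unfolding cong_def[symmetric] by (simp add: cong_add_lcancel_nat)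
      then have "b = b'"
        using lt cong_less_modulus_unique_nat by blast
      then show ?thesis using \<open>a = a'\<close> \<open>t \<noteq> t'\<close> by (simp add: t)
    qed (use eqI x y in blast)
    then show "u = v"
      using x y by (simp add: prod_eq_iff x_def y_def)
  qed
  then show ?thesis
    using finite_line[of p t] by (intro card_le_Suc0_iff_eq[THEN iffD2, folded One_nat_def]) auto
qed

lemma two_exp_minus_one_less: "2 * exp (- 1) < (1 :: real)"
proof -
  have "3 / 2 \<le> exp (1 / 2 :: real)" using exp_ge_add_one_self[of "1 / 2"] by simp
  then have "(3 / 2) * (3 / 2) \<le> exp (1 / 2 :: real) * exp (1 / 2)" by (intro mult_mono) auto
  then have "2 < exp (1 :: real)" by (simp flip: exp_add)
  then show ?thesis by (simp add: exp_minus field_simps)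
qed

section \<open>Double counting and greedy hitting sets\<close>

lemma sum_card_inter_swap:
  assumes "finite T" "finite B"
  shows "(\<Sum>t\<in>T. card {b \<in> B. t \<in> L b}) = (\<Sum>b\<in>B. card (L b \<inter> T))"
proof -
  have "(\<Sum>t\<in>T. card {b \<in> B. t \<in> L b}) = (\<Sum>t\<in>T. \<Sum>b\<in>B. if t \<in> L b then 1 else 0)"
    using assms by (simp add: sum.If_cases Int_def)
  also have "\<dots> = (\<Sum>b\<in>B. \<Sum>t\<in>T. if t \<in> L b then 1 else 0)"
    by (rule sum.swap)
  also have "\<dots> = (\<Sum>b\<in>B. card (L b \<inter> T))"
    using assms by (simp add: sum.If_cases Int_def conj_commute)
  finally show ?thesis .
qed

text \<open>A second moment argument: heaviness makes the multiplicities \<open>d t\<close> large on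
  average over \<open>T\<close>, small intersections keep their squares small, and both are
  compatible only for few sets.\<close>

lemma few_heavy_sets:
  fixes L :: "'b \<Rightarrow> 'a set" and p :: nat
  assumes "finite B" "finite T" and "p > 0" and T: "8 * card T \<le> p\<^sup>2"
    and card_L: "\<And>b. b \<in> B \<Longrightarrow> card (L b) = p"
    and inter: "\<And>b b'. b \<in> B \<Longrightarrow> b' \<in> B \<Longrightarrow> b \<noteq> b' \<Longrightarrow> card (L b \<inter> L b') \<le> 1"
    and heavy: "\<And>b. b \<in> B \<Longrightarrow> p \<le> 2 * card (L b \<inter> T)"
  shows "card B \<le> p"
proof -
  define d where "d = (\<lambda>t. card {b \<in> B. t \<in> L b})"
  define N where "N = card B"
  have finL: "finite (L b)" if "b \<in> B" for b
    using card_L[OF that] \<open>p > 0\<close> by (metis card.infinite less_irrefl)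
  have "N * p \<le> (\<Sum>b\<in>B. 2 * card (L b \<inter> T))"
    unfolding N_def using heavy by (intro sum_bounded_below[of B p, simplified]) auto
  also have "\<dots> = 2 * (\<Sum>t\<in>T. d t)"
    unfolding d_def sum_card_inter_swap[OF assms(2,1)] by (simp add: sum_distrib_left)
  finally have d1: "N * p \<le> 2 * (\<Sum>t\<in>T. d t)" .
  have "(\<Sum>t\<in>T. d t * d t) = (\<Sum>t\<in>T. card {q \<in> B \<times> B. t \<in> L (fst q) \<inter> L (snd q)})"
  proof (rule sum.cong[OF refl])
    fix t
    have "{q \<in> B \<times> B. t \<in> L (fst q) \<inter> L (snd q)} = {b \<in> B. t \<in> L b} \<times> {b \<in> B. t \<in> L b}"
      by auto
    then show "d t * d t = card {q \<in> B \<times> B. t \<in> L (fst q) \<inter> L (snd q)}"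
      by (simp add: d_def card_cartesian_product)
  qed
  also have "\<dots> = (\<Sum>q\<in>B \<times> B. card (L (fst q) \<inter> L (snd q) \<inter> T))"
    using assms by (intro sum_card_inter_swap) auto
  also have "\<dots> \<le> (\<Sum>q\<in>B \<times> B. (if fst q = snd q then p else 0) + 1)"
  proof (rule sum_mono)
    fix q assume q: "q \<in> B \<times> B"
    have "card (L (fst q) \<inter> L (snd q) \<inter> T) \<le> card (L (fst q) \<inter> L (snd q))"
      using q finL by (intro card_mono) auto
    also have "\<dots> \<le> (if fst q = snd q then p else 0) + 1"
      using q inter[of "fst q" "snd q"] card_L[of "fst q"] by (auto split: if_splits)
    finally show "card (L (fst q) \<inter> L (snd q) \<inter> T) \<le> (if fst q = snd q then p else 0) + 1" .
  qed
  also have "\<dots> = (\<Sum>b\<in>B. \<Sum>b'\<in>B. (if b = b' then p else 0) + 1)"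
    by (simp add: sum.cartesian_product case_prod_beta)
  also have "\<dots> = N * p + N * N"
    unfolding sum.distrib using \<open>finite B\<close> by (simp add: N_def)
  finally have d2: "(\<Sum>t\<in>T. d t * d t) \<le> N * p + N * N" .
  \<comment> \<open>For \<open>card T = p\<^sup>2 / 8\<close> the lower bound on the average of
    \<open>d\<close> is \<open>4 * N / p\<close>. Deviations are measured from this value.\<close>
  have "0 \<le> (\<Sum>t\<in>T. (real p * d t - 4 * N)\<^sup>2)"
    by (rule sum_nonneg) simp
  also have "\<dots> = (\<Sum>t\<in>T. (real p)\<^sup>2 * (real (d t) * d t) - 8 * (N * real p) * d t + 16 * (real N)\<^sup>2)"
    by (rule sum.cong) (auto simp: power2_eq_square algebra_simps)
  also have "\<dots> = (real p)\<^sup>2 * (\<Sum>t\<in>T. real (d t) * d t) - 8 * (N * real p) * (\<Sum>t\<in>T. real (d t)) + 16 * (real N)\<^sup>2 * card T"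
    by (simp add: sum.distrib sum_subtractf sum_distrib_left)
  also have "\<dots> \<le> (real p)\<^sup>2 * (N * real p + N * real N) - 8 * (N * real p) * (N * real p / 2) + 16 * (real N)\<^sup>2 * ((real p)\<^sup>2 / 8)"
  proof (intro add_mono diff_mono mult_left_mono)
    show "(\<Sum>t\<in>T. real (d t) * d t) \<le> N * real p + N * real N"
      using of_nat_mono[OF d2, where 'a = real] by simp
    show "N * real p / 2 \<le> (\<Sum>t\<in>T. real (d t))"
      using of_nat_mono[OF d1, where 'a = real] by simp
    show "real (card T) \<le> (real p)\<^sup>2 / 8"
      using of_nat_mono[OF T, where 'a = real] by simp
  qed auto
  also have "\<dots> = (real p)\<^sup>2 * N * (real p - N)"
    by (simp add: power2_eq_square algebra_simps)
  finally have "0 \<le> (real p)\<^sup>2 * N * (real p - N)" .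
  moreover have "(real p)\<^sup>2 * N > 0" if "N > 0" using \<open>p > 0\<close> that by simp
  ultimately have "0 \<le> real p - N" if "N > 0" using that by (metis zero_le_mult_iff not_less)
  then show ?thesis
    unfolding N_def by (cases "card B = 0") auto
qed

text \<open>By averaging, some point of \<open>X\<close> lies in a fraction \<open>1 / r\<close> of
  the sets not hit so far; adding it shrinks their number by \<open>1 - 1 / r\<close>.\<close>

lemma greedy_hitting_set:
  fixes r :: nat
  assumes "finite X" "X \<noteq> {}" "finite F" "r > 0"
    and dense: "\<And>b. b \<in> F \<Longrightarrow> card X \<le> r * card (L b \<inter> X)"
  shows "\<exists>H \<subseteq> X. card H \<le> k \<and> real (card {b \<in> F. L b \<inter> H = {}}) \<le> card F * (1 - 1 / r) ^ k"
proof (induction k)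
  case 0
  then show ?case by (intro exI[of _ "{}"]) simp
next
  case (Suc k)
  then obtain H where H: "H \<subseteq> X" "card H \<le> k"
    and IH: "real (card {b \<in> F. L b \<inter> H = {}}) \<le> card F * (1 - 1 / r) ^ k" by blast
  define U where "U = {b \<in> F. L b \<inter> H = {}}"
  have "finite U" "U \<subseteq> F" using \<open>finite F\<close> by (auto simp: U_def)
  have "\<exists>x\<in>X. card U \<le> r * card {b \<in> U. x \<in> L b}"
  proof (rule ccontr)
    assume "\<not> ?thesis"
    then have "(\<Sum>x\<in>X. r * card {b \<in> U. x \<in> L b}) < (\<Sum>x\<in>X. card U)"
      using assms by (intro sum_strict_mono) (auto simp: not_le)
    also have "\<dots> = (\<Sum>b\<in>U. card X)" by (simp add: mult.commute)
    also have "\<dots> \<le> (\<Sum>b\<in>U. r * card (L b \<inter> X))"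
      using dense \<open>U \<subseteq> F\<close> by (intro sum_mono) auto
    also have "\<dots> = (\<Sum>x\<in>X. r * card {b \<in> U. x \<in> L b})"
      using sum_card_inter_swap[OF \<open>finite X\<close> \<open>finite U\<close>, of L] by (simp flip: sum_distrib_left)
    finally show False by simp
  qed
  then obtain x where x: "x \<in> X" "card U \<le> r * card {b \<in> U. x \<in> L b}" by blast
  define U' where "U' = {b \<in> F. L b \<inter> insert x H = {}}"
  have "U' = U - {b \<in> U. x \<in> L b}"
    by (auto simp: U_def U'_def)
  then have "real (card U') = real (card U) - card {b \<in> U. x \<in> L b}"
    using \<open>finite U\<close> by (simp add: card_Diff_subset of_nat_diff card_mono)
  also have "\<dots> \<le> real (card U) - card U / r"
  proof -
    have "real (card U) \<le> r * real (card {b \<in> U. x \<in> L b})"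
      using x(2) by (metis of_nat_le_iff of_nat_mult)
    then show ?thesis using \<open>r > 0\<close> by (simp add: divide_le_eq mult.commute)
  qed
  also have "\<dots> = card U * (1 - 1 / r)"
    by (simp add: algebra_simps)
  also have "\<dots> \<le> (card F * (1 - 1 / r) ^ k) * (1 - 1 / r)"
    using IH \<open>r > 0\<close> unfolding U_def by (intro mult_right_mono) auto
  finally have "real (card U') \<le> card F * (1 - 1 / r) ^ Suc k"
    by (simp add: mult_ac)
  moreover have "card (insert x H) \<le> Suc k"
    using H(2) by (metis card_insert_if Suc_le_mono le_SucI finite_subset[OF H(1) \<open>finite X\<close>])
  ultimately show ?case
    unfolding U'_def using H(1) x(1) by (intro exI[of _ "insert x H"]) auto
qed

text \<open>
  A pair \<open>(A, Z)\<close> is a certificate that requires ones on \<open>A\<close> and zeros on \<open>Z\<close>. \<open>C0\<close> and \<open>C1\<close> are the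
  certificates of the two values of a partial function for which the all-zero string is a hard point:
  \<open>D\<close> of its bits never rule out a value.
\<close>

definition hard_point :: "'a set \<Rightarrow> nat \<Rightarrow> nat \<Rightarrow> ('a set \<times> 'a set) set \<Rightarrow> ('a set \<times> 'a set) set \<Rightarrow> bool" where
  "hard_point X L D C0 C1 \<longleftrightarrow>
    (\<forall>A Z. (A, Z) \<in> C0 \<union> C1 \<longrightarrow> A \<subseteq> X \<and> Z \<subseteq> X \<and> A \<inter> Z = {} \<and> A \<noteq> {} \<and> card A \<le> L \<and> card Z \<le> L) \<and>
    (\<forall>A Z A' Z'. (A, Z) \<in> C0 \<longrightarrow> (A', Z') \<in> C1 \<longrightarrow> A \<inter> Z' \<noteq> {} \<or> A' \<inter> Z \<noteq> {}) \<and>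
    (\<forall>S\<subseteq>X. card S \<le> D \<longrightarrow> (\<exists>A Z. (A, Z) \<in> C0 \<and> A \<inter> S = {}) \<and> (\<exists>A Z. (A, Z) \<in> C1 \<and> A \<inter> S = {}))"

text \<open>
  A \<open>C0\<close>-certificate is a marked line together with the absence of marks on its points. A
  \<open>C1\<close>-certificate consists of marked points that hit all lines except for at most \<open>p\<close>, which are
  unmarked. Given a set \<open>T\<close> of points that may not be marked, these exceptions are the lines
  that lie mostly in \<open>T\<close>.
\<close>

lemma hard_point_lines:
  fixes p l :: nat
  assumes "prime p" and p: "p \<le> 2 ^ l" and "l > 0"
  defines "P \<equiv> {..<p} \<times> {..<p}"
  shows "\<exists>C0 C1. hard_point (P <+> P) (4 * p * l) (p\<^sup>2 div 8) C0 C1"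
proof -
  define C0 where "C0 = (\<lambda>t. ({Inr t :: nat \<times> nat + nat \<times> nat}, Inl ` line p t :: (nat \<times> nat + nat \<times> nat) set)) ` P"
  define C1 where "C1 = {(Inl ` H :: (nat \<times> nat + nat \<times> nat) set, Inr ` Q :: (nat \<times> nat + nat \<times> nat) set) | H Q.
      H \<subseteq> P \<and> Q \<subseteq> P \<and> card H \<le> 4 * p * l \<and> card Q \<le> p \<and> (\<forall>t\<in>P - Q. line p t \<inter> H \<noteq> {})}"
  have "p \<ge> 2" using \<open>prime p\<close> by (rule prime_ge_2_nat)
  have "finite P" "card P = p\<^sup>2" by (simp_all add: P_def card_cartesian_product power2_eq_square)
  have "p < p\<^sup>2" using \<open>p \<ge> 2\<close> by (simp add: power2_eq_square)
  have "p \<le> 4 * p * l" "1 \<le> 4 * p * l" using \<open>l > 0\<close> \<open>p \<ge> 2\<close> by auto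
  have lineP: "line p t \<subseteq> P" for t unfolding P_def by (rule line_subset)
  have c0: "A \<subseteq> P <+> P \<and> Z \<subseteq> P <+> P \<and> A \<inter> Z = {} \<and> A \<noteq> {} \<and> card A \<le> 4 * p * l \<and> card Z \<le> 4 * p * l"
    if AZ: "(A, Z) \<in> C0" for A Z
  proof -
    obtain t where t: "t \<in> P" "A = {Inr t}" "Z = Inl ` line p t" using AZ unfolding C0_def by blast
    have "card Z = p" "card A = 1" by (simp_all add: t card_image card_line)
    moreover have "A \<subseteq> P <+> P" "Z \<subseteq> P <+> P" "A \<inter> Z = {}" "A \<noteq> {}" using t lineP[of t] by auto
    ultimately show ?thesis using \<open>p \<le> 4 * p * l\<close> \<open>1 \<le> 4 * p * l\<close> by presburger
  qed
  have c1: "A \<subseteq> P <+> P \<and> Z \<subseteq> P <+> P \<and> A \<inter> Z = {} \<and> A \<noteq> {} \<and> card A \<le> 4 * p * l \<and> card Z \<le> 4 * p * l"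
    if AZ: "(A, Z) \<in> C1" for A Z
  proof -
    obtain H Q where HQ: "A = Inl ` H" "Z = Inr ` Q" "H \<subseteq> P" "Q \<subseteq> P" "card H \<le> 4 * p * l" "card Q \<le> p"
      "\<forall>t\<in>P - Q. line p t \<inter> H \<noteq> {}"
      using AZ unfolding C1_def by blast
    have "\<not> P \<subseteq> Q"
    proof
      assume "P \<subseteq> Q"
      then have "P = Q" using HQ(4) by simp
      then show False using HQ(6) \<open>card P = p\<^sup>2\<close> \<open>p < p\<^sup>2\<close> by simp
    qed
    then have "H \<noteq> {}" using HQ(7) by blast
    moreover have "card A = card H" "card Z = card Q" by (simp_all add: HQ card_image)
    moreover have "A \<subseteq> P <+> P" "Z \<subseteq> P <+> P" "A \<inter> Z = {}" using HQ by auto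
    moreover have "card Q \<le> 4 * p * l" using HQ(6) \<open>p \<le> 4 * p * l\<close> by (rule le_trans)
    ultimately show ?thesis using HQ(1,5) by simp
  qed
  have conflict: "A \<inter> Z' \<noteq> {} \<or> A' \<inter> Z \<noteq> {}" if AZ: "(A, Z) \<in> C0" "(A', Z') \<in> C1" for A Z A' Z'
  proof -
    obtain t where t: "t \<in> P" "A = {Inr t}" "Z = Inl ` line p t" using AZ(1) unfolding C0_def by blast
    obtain H Q where HQ: "A' = Inl ` H" "Z' = Inr ` Q" "\<forall>t\<in>P - Q. line p t \<inter> H \<noteq> {}"
      using AZ(2) unfolding C1_def by blast
    show ?thesis
    proof (cases "t \<in> Q")
      case False
      then obtain x where "x \<in> line p t" "x \<in> H" using HQ(3) t(1) by blast
      then show ?thesis using t HQ by blast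
    qed (use t HQ in blast)
  qed
  have avoid0: "\<exists>A Z. (A, Z) \<in> C0 \<and> A \<inter> S = {}" if S: "S \<subseteq> P <+> P" "card S \<le> p\<^sup>2 div 8" for S
  proof -
    have "finite S" using S \<open>finite P\<close> by (auto intro: finite_subset)
    have "\<not> Inr ` P \<subseteq> S"
    proof
      assume "Inr ` P \<subseteq> S"
      then have "card P \<le> card S"
        using card_mono[OF \<open>finite S\<close>, of "Inr ` P"] by (simp add: card_image)
      then show False using \<open>p < p\<^sup>2\<close> S(2) \<open>card P = p\<^sup>2\<close> by linarith
    qed
    then obtain t where "t \<in> P" "Inr t \<notin> S" by auto
    then show ?thesis by (auto simp: C0_def)
  qed
  have avoid1: "\<exists>A Z. (A, Z) \<in> C1 \<and> A \<inter> S = {}" if S: "S \<subseteq> P <+> P" "card S \<le> p\<^sup>2 div 8" for S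
  proof -
    have "finite S" using S \<open>finite P\<close> by (auto intro: finite_subset)
    define T where "T = {x \<in> P. Inl x \<in> S}"
    have "finite T" using \<open>finite P\<close> by (simp add: T_def)
    have "card T = card (Inl ` T :: (nat \<times> nat + nat \<times> nat) set)" by (simp add: card_image)
    also have "\<dots> \<le> card S" using \<open>finite S\<close> by (intro card_mono) (auto simp: T_def)
    finally have cardT: "8 * card T \<le> p\<^sup>2" using S(2) by simp
    \<comment> \<open>A line outside \<open>Q\<close> keeps at least \<open>p / 2\<close> points in
      \<open>X\<close>, which is at least a fraction \<open>1 / (2 * p)\<close> of \<open>X\<close>:
      the density for the greedy choice.\<close>
    define Q where "Q = {t \<in> P. p \<le> 2 * card (line p t \<inter> T)}"
    have "card Q \<le> p"
    proof (rule few_heavy_sets[OF _ \<open>finite T\<close> _ cardT, of _ "line p"])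
      show "card (line p t \<inter> line p t') \<le> 1" if "t \<in> Q" "t' \<in> Q" "t \<noteq> t'" for t t'
        using line_inter[OF \<open>prime p\<close>] that by (auto simp: Q_def P_def)
    qed (use \<open>finite P\<close> \<open>p \<ge> 2\<close> in \<open>auto simp: Q_def card_line\<close>)
    define F where "F = P - Q"
    define X where "X = P - T"
    have "card T < card P" using cardT \<open>card P = p\<^sup>2\<close> \<open>p < p\<^sup>2\<close> by linarith
    then have "X \<noteq> {}" unfolding X_def using card_mono[OF \<open>finite T\<close>, of P] by auto
    have dense: "card X \<le> 2 * p * card (line p t \<inter> X)" if "t \<in> F" for t
    proof -
      have "line p t \<inter> X = line p t - line p t \<inter> T" using lineP[of t] unfolding X_def by blast
      then have "card (line p t \<inter> X) = p - card (line p t \<inter> T)"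
        using finite_line by (simp add: card_Diff_subset card_line)
      then have "p \<le> 2 * card (line p t \<inter> X)" using that by (auto simp: F_def Q_def)
      then have "p * p \<le> p * (2 * card (line p t \<inter> X))" by (rule mult_le_mono2)
      also have "\<dots> = 2 * p * card (line p t \<inter> X)" by (simp only: ac_simps)
      finally have "p * p \<le> 2 * p * card (line p t \<inter> X)" .
      moreover have "card X \<le> p * p"
        using card_mono[OF \<open>finite P\<close>, of X] \<open>card P = p\<^sup>2\<close> by (simp add: X_def power2_eq_square)
      ultimately show ?thesis by linarith
    qed
    \<comment> \<open>After \<open>4 * p * l\<close> rounds at most
      \<open>p\<^sup>2 * exp (- 2 * l)\<close> lines are missed, fewer than one because
      \<open>p \<le> 2 ^ l\<close>.\<close>
    obtain H where H: "H \<subseteq> X" "card H \<le> 4 * p * l"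
      and left: "real (card {t \<in> F. line p t \<inter> H = {}}) \<le> card F * (1 - 1 / real (2 * p)) ^ (4 * p * l)"
      using greedy_hitting_set[of X F "2 * p" "line p" "4 * p * l"] dense \<open>X \<noteq> {}\<close> \<open>finite P\<close> \<open>p \<ge> 2\<close>
      unfolding X_def F_def by auto
    have "card F \<le> p\<^sup>2"
      using card_mono[OF \<open>finite P\<close>, of F] \<open>card P = p\<^sup>2\<close> by (simp add: F_def)
    also have "\<dots> \<le> (2 ^ l)\<^sup>2" using p by (rule power_mono) simp
    also have "\<dots> = 2 ^ (2 * l)" by (simp add: mult.commute flip: power_mult)
    finally have "real (card F) \<le> real (2 ^ (2 * l))" by (rule of_nat_mono)
    also have "\<dots> = 2 ^ (2 * l)" by simp
    finally have cardF: "real (card F) \<le> 2 ^ (2 * l)" .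
    have "(1 - 1 / real (2 * p)) ^ (4 * p * l) \<le> exp (- 1 / real (2 * p)) ^ (4 * p * l)"
      using exp_ge_add_one_self[of "- 1 / real (2 * p)"] \<open>p \<ge> 2\<close> by (intro power_mono) auto
    also have "\<dots> = exp (- 1) ^ (2 * l)"
      using \<open>p \<ge> 2\<close> by (simp flip: exp_of_nat_mult)
    finally have "card F * (1 - 1 / real (2 * p)) ^ (4 * p * l) \<le> 2 ^ (2 * l) * exp (- 1) ^ (2 * l)"
      using cardF \<open>p \<ge> 2\<close> by (intro mult_mono) auto
    also have "\<dots> = (2 * exp (- 1)) ^ (2 * l)" by (simp add: power_mult_distrib)
    also have "\<dots> < 1"
      using two_exp_minus_one_less \<open>l > 0\<close> by (subst power_less_one_iff) auto
    finally have "card {t \<in> F. line p t \<inter> H = {}} = 0" using left by linarith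
    then have "\<forall>t\<in>P - Q. line p t \<inter> H \<noteq> {}"
      using \<open>finite P\<close> by (auto simp: F_def)
    then have "(Inl ` H, Inr ` Q) \<in> C1"
      using H \<open>card Q \<le> p\<close> unfolding C1_def X_def Q_def by blast
    moreover have "Inl ` H \<inter> S = {}"
      using H(1) by (auto simp: X_def T_def)
    ultimately show ?thesis by blast
  qed
  have "hard_point (P <+> P) (4 * p * l) (p\<^sup>2 div 8) C0 C1"
    unfolding hard_point_def
    by (intro conjI allI impI; (rule avoid0 avoid1 conflict; assumption)?; use c0 c1 in blast)
  then show ?thesis by blast
qed

section \<open>Cheat sheets\<close>

text \<open>Unambiguous 1-certificates of a total function. \<open>A \<noteq> {}\<close> makes the
  zero string a 0-input; the last clause says that no \<open>D\<close> of its bits certify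
  this.\<close>

definition certificate_family :: "'i set \<Rightarrow> nat \<Rightarrow> nat \<Rightarrow> ('i set \<times> 'i set) set \<Rightarrow> bool" where
  "certificate_family J r D U \<longleftrightarrow>
    (\<forall>A Z. (A, Z) \<in> U \<longrightarrow> A \<subseteq> J \<and> Z \<subseteq> J \<and> A \<inter> Z = {} \<and> A \<noteq> {} \<and> card (A \<union> Z) \<le> r) \<and>
    (\<forall>A Z A' Z'. (A, Z) \<in> U \<longrightarrow> (A', Z') \<in> U \<longrightarrow> (A, Z) \<noteq> (A', Z') \<longrightarrow> A \<inter> Z' \<noteq> {} \<or> A' \<inter> Z \<noteq> {}) \<and>
    (\<forall>S \<subseteq> J. card S \<le> D \<longrightarrow> (\<exists>A Z. (A, Z) \<in> U \<and> A \<inter> S = {}))"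

text \<open>
  The cheat sheet construction: \<open>c\<close> copies of \<open>X\<close> together with a table whose cell \<open>u \<subseteq> {..<c}\<close> has \<open>b\<close> bits.
  A certificate consists of one cell \<open>u\<close> together with the certificates, encoded by this cell, that the
  \<open>j\<close>-th copy has value \<open>j \<in> u\<close>. Since the copies have at most one value, at most one cell is consistent.
\<close>

lemma cheat_sheet:
  fixes X :: "'a set"
  assumes "finite X" and hard: "hard_point X L D C0 C1" and "c > 0" and D: "D < 2 ^ c"
    and b: "card (C0 \<union> C1) ^ c \<le> 2 ^ b"
  shows "\<exists>U. certificate_family (({..<c} \<times> X) <+> (Pow {..<c} \<times> {..<b})) (2 * c * L + b) D U
    \<and> finite U \<and> card U \<le> 2 ^ c * 2 ^ b"
proof -
  define J where "J = ({..<c} \<times> X) <+> (Pow {..<c} \<times> {..<b})"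
  have cert: "A \<subseteq> X \<and> Z \<subseteq> X \<and> A \<inter> Z = {} \<and> A \<noteq> {} \<and> card A \<le> L \<and> card Z \<le> L" if "(A, Z) \<in> C0 \<union> C1" for A Z
    by (rule hard[unfolded hard_point_def, THEN conjunct1, rule_format, OF that])
  have conflict: "A \<inter> Z' \<noteq> {} \<or> A' \<inter> Z \<noteq> {}" if "(A, Z) \<in> C0" "(A', Z') \<in> C1" for A Z A' Z'
    by (rule hard[unfolded hard_point_def, THEN conjunct2, THEN conjunct1, rule_format, OF that])
  have avoid: "\<exists>q\<in>C0. fst q \<inter> S = {}" "\<exists>q\<in>C1. fst q \<inter> S = {}" if "S \<subseteq> X" "card S \<le> D" for S
    using hard[unfolded hard_point_def, THEN conjunct2, THEN conjunct2, rule_format, OF that]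
    by (simp_all add: Bex_def)
  have finC: "finite (C0 \<union> C1)"
  proof (rule finite_subset)
    show "C0 \<union> C1 \<subseteq> Pow X \<times> Pow X"
    proof
      fix q assume "q \<in> C0 \<union> C1"
      then show "q \<in> Pow X \<times> Pow X" using cert[of "fst q" "snd q"] by (simp add: mem_Times_iff)
    qed
  qed (use \<open>finite X\<close> in auto)
  define T where "T = PiE {..<c} (\<lambda>_. C0 \<union> C1)"
  have finT: "finite T" unfolding T_def using finC by (intro finite_PiE) auto
  have "card T = card (C0 \<union> C1) ^ c" by (simp add: T_def card_PiE)
  then have "card T \<le> card (Pow {..<b})" using b by (simp add: card_Pow)
  \<comment> \<open>\<open>e\<close> writes a tuple of certificates into a cell as the set of its
    one-bits.\<close>
  then obtain e where e: "e ` T \<subseteq> Pow {..<b}" "inj_on e T"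
    using card_le_inj[OF finT, of "Pow {..<b}"] by auto
  define C where "C = (\<lambda>u (j :: nat). if j \<in> u then C1 else C0)"
  have CC: "C u j \<subseteq> C0 \<union> C1" for u j by (auto simp: C_def)
  define ones where "ones = (\<lambda>(u :: nat set, k). (SIGMA j : {..<c}. fst (k j)) <+> ({u} \<times> e k))"
  define zeros where "zeros = (\<lambda>(u :: nat set, k). (SIGMA j : {..<c}. snd (k j)) <+> ({u} \<times> ({..<b} - e k)))"
  define Q where "Q = (SIGMA u : Pow {..<c}. PiE {..<c} (C u))"
  define U where "U = (\<lambda>q. (ones q, zeros q)) ` Q"
  have QT: "k \<in> T" "u \<subseteq> {..<c}" if "(u, k) \<in> Q" for u k
    using that PiE_mono[of "{..<c}" "C u" "\<lambda>_. C0 \<union> C1"] CC unfolding Q_def T_def by blast+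
  have kj: "k j \<in> C u j" if "(u, k) \<in> Q" "j < c" for u k j
    using that by (auto simp: Q_def PiE_iff)
  have ek: "e k \<subseteq> {..<b}" if "(u, k) \<in> Q" for u k
    using QT(1)[OF that] e by auto
  have Qsub: "Q \<subseteq> Pow {..<c} \<times> T" using QT by (intro subrelI) blast
  have "finite Q" using finite_subset[OF Qsub] finT by auto
  have "card U \<le> card Q" unfolding U_def using \<open>finite Q\<close> by (rule card_image_le)
  also have "\<dots> \<le> card (Pow {..<c} \<times> T)" using Qsub finT by (intro card_mono) auto
  also have "\<dots> \<le> 2 ^ c * 2 ^ b"
    using \<open>card T \<le> card (Pow {..<b})\<close> by (simp add: card_cartesian_product card_Pow)
  finally have cardU: "card U \<le> 2 ^ c * 2 ^ b" .
  have "certificate_family J (2 * c * L + b) D U"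
    unfolding certificate_family_def
  proof (intro conjI allI impI)
    fix A Z assume "(A, Z) \<in> U"
    then obtain u k where q: "(u, k) \<in> Q" and AZ: "A = ones (u, k)" "Z = zeros (u, k)"
      unfolding U_def by auto
    have kc: "fst (k j) \<subseteq> X \<and> snd (k j) \<subseteq> X \<and> fst (k j) \<inter> snd (k j) = {} \<and> fst (k j) \<noteq> {} \<and>
      card (fst (k j)) \<le> L \<and> card (snd (k j)) \<le> L" if "j < c" for j
      using cert[of "fst (k j)" "snd (k j)"] subsetD[OF CC kj[OF q that]] by simp
    show "A \<subseteq> J" "Z \<subseteq> J"
    proof -
      have "(SIGMA j : {..<c}. fst (k j)) \<subseteq> {..<c} \<times> X" "(SIGMA j : {..<c}. snd (k j)) \<subseteq> {..<c} \<times> X"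
        using kc by blast+
      moreover have "{u} \<times> e k \<subseteq> Pow {..<c} \<times> {..<b}" "{u} \<times> ({..<b} - e k) \<subseteq> Pow {..<c} \<times> {..<b}"
        using QT(2)[OF q] ek[OF q] by blast+
      ultimately show "A \<subseteq> J" "Z \<subseteq> J"
        unfolding AZ ones_def zeros_def J_def prod.case Plus_def by (blast intro: Un_mono image_mono)+
    qed
    show "A \<inter> Z = {}"
      using kc unfolding AZ ones_def zeros_def prod.case by blast
    show "A \<noteq> {}"
      using kc[OF \<open>c > 0\<close>] \<open>c > 0\<close> by (auto simp: AZ ones_def)
    have fin: "finite (fst (k j))" "finite (snd (k j))" if "j < c" for j
      using kc[OF that] \<open>finite X\<close> by (auto intro: finite_subset)
    have "A \<union> Z \<subseteq> (SIGMA j : {..<c}. fst (k j) \<union> snd (k j)) <+> ({u} \<times> {..<b})"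
      using ek[OF q] by (auto simp: AZ ones_def zeros_def)
    then have "card (A \<union> Z) \<le> card ((SIGMA j : {..<c}. fst (k j) \<union> snd (k j)) <+> ({u} \<times> {..<b}))"
      using fin by (intro card_mono finite_Plus finite_SigmaI) auto
    also have "\<dots> = (\<Sum>j<c. card (fst (k j) \<union> snd (k j))) + b"
      using fin by (subst card_Plus) (auto simp: card_cartesian_product)
    also have "\<dots> \<le> (\<Sum>j<c. 2 * L) + b"
    proof (intro add_right_mono sum_mono)
      fix j assume "j \<in> {..<c}"
      then show "card (fst (k j) \<union> snd (k j)) \<le> 2 * L"
        using kc[of j] card_Un_le[of "fst (k j)" "snd (k j)"] by simp
    qed
    finally show "card (A \<union> Z) \<le> 2 * c * L + b" by simp
  next
    fix A Z A' Z' assume U: "(A, Z) \<in> U" "(A', Z') \<in> U" and ne: "(A, Z) \<noteq> (A', Z')"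
    obtain u k where q: "(u, k) \<in> Q" and AZ: "A = ones (u, k)" "Z = zeros (u, k)"
      using U(1) unfolding U_def by auto
    obtain u' k' where q': "(u', k') \<in> Q" and AZ': "A' = ones (u', k')" "Z' = zeros (u', k')"
      using U(2) unfolding U_def by auto
    show "A \<inter> Z' \<noteq> {} \<or> A' \<inter> Z \<noteq> {}"
    \<comment> \<open>Different cells claim opposite values for some copy, whose certificates then
      conflict; within one cell, different tuples have different codes.\<close>
    proof (cases "u = u'")
      case False
      then obtain j where j: "j < c" "j \<in> u \<and> j \<notin> u' \<or> j \<notin> u \<and> j \<in> u'"
        using QT(2)[OF q] QT(2)[OF q'] by blast
      then have "fst (k j) \<inter> snd (k' j) \<noteq> {} \<or> fst (k' j) \<inter> snd (k j) \<noteq> {}"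
        using conflict[of "fst (k j)" "snd (k j)" "fst (k' j)" "snd (k' j)"]
          conflict[of "fst (k' j)" "snd (k' j)" "fst (k j)" "snd (k j)"]
          kj[OF q j(1)] kj[OF q' j(1)] by (auto simp: C_def)
      then obtain a where "a \<in> fst (k j) \<inter> snd (k' j) \<or> a \<in> fst (k' j) \<inter> snd (k j)" by blast
      then have "Inl (j, a) \<in> A \<inter> Z' \<or> Inl (j, a) \<in> A' \<inter> Z"
        using j(1) by (auto simp: AZ AZ' ones_def zeros_def)
      then show ?thesis by blast
    next
      case True
      then have "k \<noteq> k'" using ne by (auto simp: AZ AZ')
      then have "e k \<noteq> e k'"
        using e(2) QT(1)[OF q] QT(1)[OF q'] by (auto dest: inj_onD)
      then obtain i where "i \<in> e k \<and> i \<notin> e k' \<or> i \<in> e k' \<and> i \<notin> e k" by blast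
      then have "Inr (u, i) \<in> A \<inter> Z' \<or> Inr (u, i) \<in> A' \<inter> Z"
        using ek[OF q] ek[OF q'] True by (auto simp: AZ AZ' ones_def zeros_def)
      then show ?thesis by blast
    qed
  next
    fix S assume S: "S \<subseteq> J" "card S \<le> D"
    have "finite J" using \<open>finite X\<close> by (simp add: J_def)
    then have "finite S" using S finite_subset by blast
    \<comment> \<open>Since \<open>D < 2 ^ c\<close>, some cell \<open>u\<close> is untouched by
      \<open>S\<close>. It dictates the values of the copies, each of which still has a certificate
      whose ones avoid \<open>S\<close>.\<close>
    define S2 where "S2 = {u. \<exists>i. Inr (u, i) \<in> S}"
    have "S2 \<subseteq> (\<lambda>s. fst (projr s)) ` S" by (force simp: S2_def)
    then have "card S2 \<le> card S" and "finite S2"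
      using \<open>finite S\<close> by (auto intro: surj_card_le finite_subset)
    then have "card S2 < card (Pow {..<c})" using S D by (simp add: card_Pow)
    then have "\<not> Pow {..<c} \<subseteq> S2" using card_mono[OF \<open>finite S2\<close>, of "Pow {..<c}"] by auto
    then obtain u where u: "u \<subseteq> {..<c}" "u \<notin> S2" by auto
    define S1 where "S1 = (\<lambda>j. {a. Inl (j, a) \<in> S})"
    have "\<exists>q\<in>C u j. fst q \<inter> S1 j = {}" for j
    proof -
      have "S1 j \<subseteq> X" using S(1) by (auto simp: S1_def J_def)
      moreover have "card (S1 j) = card ((\<lambda>a. Inl (j, a) :: nat \<times> 'a + nat set \<times> nat) ` S1 j)"
        by (simp add: card_image inj_on_def)
      moreover have "\<dots> \<le> card S" using \<open>finite S\<close> by (intro card_mono) (auto simp: S1_def)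
      ultimately show ?thesis using avoid[of "S1 j"] S(2) by (auto simp: C_def)
    qed
    then obtain g where g: "\<And>j. g j \<in> C u j" "\<And>j. fst (g j) \<inter> S1 j = {}" by metis
    define k where "k = restrict g {..<c}"
    have "(u, k) \<in> Q" using u(1) g(1) by (auto simp: Q_def k_def)
    then have "(ones (u, k), zeros (u, k)) \<in> U" unfolding U_def by blast
    moreover have "ones (u, k) \<inter> S = {}"
      using g(2) u(2) by (auto simp: ones_def k_def S1_def S2_def) blast
    ultimately show "\<exists>A Z. (A, Z) \<in> U \<and> A \<inter> S = {}" by blast
  qed
  moreover have "finite U" using \<open>finite Q\<close> by (simp add: U_def)
  ultimately show ?thesis
    using cardU unfolding J_def by - (rule exI[of _ U], intro conjI)
qed

text \<open>A small subset is coded by a list of length exactly \<open>L\<close>, padded with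
  \<open>None\<close>.\<close>

lemma card_small_subsets_le:
  assumes "finite X"
  shows "card {A. A \<subseteq> X \<and> card A \<le> L} \<le> (card X + 1) ^ L"
proof -
  let ?Y = "insert None (Some ` X)"
  have "{A. A \<subseteq> X \<and> card A \<le> L} \<subseteq> (\<lambda>xs. {a. Some a \<in> set xs}) ` {xs. set xs \<subseteq> ?Y \<and> length xs = L}"
  proof
    fix A assume A: "A \<in> {A. A \<subseteq> X \<and> card A \<le> L}"
    then have "finite A" using \<open>finite X\<close> finite_subset by auto
    then obtain xs where xs: "set xs = A" "length xs = card A"
      using finite_distinct_list[of A] distinct_card by metis
    define ys where "ys = map Some xs @ replicate (L - card A) None"
    have "A = {a. Some a \<in> set ys}" using xs by (auto simp: ys_def set_replicate_conv_if)
    moreover have "set ys \<subseteq> ?Y" "length ys = L" using xs A by (auto simp: ys_def set_replicate_conv_if)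
    ultimately show "A \<in> (\<lambda>xs. {a. Some a \<in> set xs}) ` {xs. set xs \<subseteq> ?Y \<and> length xs = L}" by blast
  qed
  then have "card {A. A \<subseteq> X \<and> card A \<le> L} \<le> card {xs. set xs \<subseteq> ?Y \<and> length xs = L}"
    using \<open>finite X\<close> by (intro surj_card_le finite_lists_length_eq) auto
  also have "\<dots> = card ?Y ^ L" using \<open>finite X\<close> by (intro card_lists_length_eq) auto
  also have "card ?Y = card X + 1" using \<open>finite X\<close> by (simp add: card_image)
  finally show ?thesis .
qed

lemma card_certificates_le:
  assumes "finite X" and "hard_point X L D C0 C1"
  shows "card (C0 \<union> C1) \<le> (card X + 1) ^ (2 * L)"
proof -
  let ?S = "{A. A \<subseteq> X \<and> card A \<le> L}"
  have "C0 \<union> C1 \<subseteq> ?S \<times> ?S"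
  proof (rule subrelI)
    fix A Z assume "(A, Z) \<in> C0 \<union> C1"
    then show "(A, Z) \<in> ?S \<times> ?S"
      using assms(2)[unfolded hard_point_def, THEN conjunct1, rule_format, of A Z] by simp
  qed
  then have "card (C0 \<union> C1) \<le> card (?S \<times> ?S)"
    using \<open>finite X\<close> by (intro card_mono) auto
  also have "\<dots> \<le> (card X + 1) ^ L * (card X + 1) ^ L"
    unfolding card_cartesian_product using \<open>finite X\<close> by (intro mult_mono card_small_subsets_le) auto
  also have "\<dots> = (card X + 1) ^ (2 * L)" by (simp add: mult_2 power_add)
  finally show ?thesis .
qed

section \<open>The lower bound\<close>

text \<open>A 1-rectangle is a certificate together with the pointers at its coordinates,
  \<open>s\<^sup>2\<close> choices for each. The square and the halved exponent come from the
  directed cover, the factor 2 and the summand 3 from regularisation.\<close>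

lemma regular_graph_of_certificate_family:
  fixes J :: "'i set" and s D r n :: nat
  assumes cf: "certificate_family J r D U" and U: "finite U"
    and J: "finite J" "card J = n" "n > 0" and s: "s \<ge> 2" and D: "D \<le> n"
    and num: "2 ^ n * real s ^ n * n * ((real (2 * s\<^sup>2) ^ n + 1) * exp (- (s / (32 * (real n)\<^sup>2)))) < 1"
  shows "\<exists>G :: nat pair_pre_digraph. pair_graph G \<and> regular_graph G \<and>
    bp G \<le> 2 * (card U * s ^ (2 * r))\<^sup>2 + 3 \<and> s ^ (D div 2) \<le> chromatic_number G"
proof -
  define e where "e = D div 2"
  define m where "m = s\<^sup>2"
  have "m > 0" using s by (simp add: m_def)
  have cert: "A \<subseteq> J" "Z \<subseteq> J" "A \<inter> Z = {}" "A \<noteq> {}" "card (A \<union> Z) \<le> r" if "(A, Z) \<in> U" for A Z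
    using cf[unfolded certificate_family_def, THEN conjunct1, rule_format, OF that] by simp_all
  have conflict: "A \<inter> Z' \<noteq> {} \<or> A' \<inter> Z \<noteq> {}"
    if "(A, Z) \<in> U" "(A', Z') \<in> U" "(A, Z) \<noteq> (A', Z')" for A Z A' Z'
    by (rule cf[unfolded certificate_family_def, THEN conjunct2, THEN conjunct1, rule_format, OF that])
  have avoid: "\<exists>A Z. (A, Z) \<in> U \<and> A \<inter> S = {}" if "S \<subseteq> J" "card S \<le> D" for S
    by (rule cf[unfolded certificate_family_def, THEN conjunct2, THEN conjunct2, rule_format, OF that])
  define V where "V = hard_inputs J m"
  have cardV: "card V > 0"
    using J \<open>m > 0\<close> by (simp add: V_def card_hard_inputs)
  then have V: "finite V" "V \<noteq> {}" by (auto simp: card_gt_0_iff)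
  define Q where "Q = (SIGMA q : U. PiE (fst q \<union> snd q) (\<lambda>_. {..<m}))"
  have finUn: "finite (fst q \<union> snd q)" if "q \<in> U" for q
    using cert[of "fst q" "snd q"] that J by (auto intro: finite_subset)
  have "finite Q" unfolding Q_def using U finUn by (intro finite_SigmaI finite_PiE) auto
  have "card Q = (\<Sum>q\<in>U. m ^ card (fst q \<union> snd q))"
    unfolding Q_def using U finUn by (subst card_SigmaI) (auto intro!: finite_PiE simp: card_PiE)
  also have "\<dots> \<le> (\<Sum>q\<in>U. m ^ r)"
    using cert(5) \<open>m > 0\<close> by (intro sum_mono power_increasing) auto
  also have "\<dots> = card U * s ^ (2 * r)"
    by (simp add: m_def power_mult)
  finally have cardQ: "card Q \<le> card U * s ^ (2 * r)" .
  define k where "k = card Q"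
  obtain h where h: "bij_betw h {0..<k} Q"
    unfolding k_def using ex_bij_betw_nat_finite[OF \<open>finite Q\<close>] by blast
  have hQ: "h i \<in> Q" if "i < k" for i using bij_betwE[OF h] that by simp
  have h_onto: "\<exists>i<k. h i = q" if "q \<in> Q" for q
    using h that unfolding bij_betw_def by (metis atLeast0LessThan imageE lessThan_iff)
  have h_inj: "i = j" if "h i = h j" "i < k" "j < k" for i j
    using bij_betw_imp_inj_on[OF h] that by (auto dest: inj_onD)
  define left :: "('i set \<times> 'i set) \<times> ('i \<Rightarrow> nat) \<Rightarrow> (('i \<Rightarrow> nat) \<times> ('i \<Rightarrow> nat set)) set"
    where "left = (\<lambda>((A, Z), \<beta>). {v \<in> V. \<forall>i\<in>A \<union> Z. fst v i = \<beta> i})"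
  define right :: "('i set \<times> 'i set) \<times> ('i \<Rightarrow> nat) \<Rightarrow> (('i \<Rightarrow> nat) \<times> ('i \<Rightarrow> nat set)) set"
    where "right = (\<lambda>((A, Z), \<beta>). {v \<in> V. (\<forall>i\<in>A. \<beta> i \<in> snd v i) \<and> (\<forall>i\<in>Z. \<beta> i \<notin> snd v i)})"
  have "k > 0"
  proof -
    obtain A Z where AZ: "(A, Z) \<in> U" using avoid[of "{}"] by auto
    have "(\<lambda>i\<in>A \<union> Z. 0) \<in> PiE (A \<union> Z) (\<lambda>_. {..<m})" using \<open>m > 0\<close> by auto
    then have "((A, Z), \<lambda>i\<in>A \<union> Z. 0) \<in> Q" using AZ by (auto simp: Q_def)
    then show ?thesis using h_onto by fastforce
  qed
  have eq_if_both: "q = q'"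
    if q: "q \<in> Q" "q' \<in> Q" and v: "u \<in> left q" "v \<in> right q" "u \<in> left q'" "v \<in> right q'" for q q' u v
  proof -
    obtain A Z \<beta> A' Z' \<beta>' where q_eq: "q = ((A, Z), \<beta>)" "q' = ((A', Z'), \<beta>')" by (metis prod.exhaust)
    have mem: "(A, Z) \<in> U" "(A', Z') \<in> U" "\<beta> \<in> PiE (A \<union> Z) (\<lambda>_. {..<m})" "\<beta>' \<in> PiE (A' \<union> Z') (\<lambda>_. {..<m})"
      using q by (auto simp: q_eq Q_def)
    have l: "\<And>i. i \<in> A \<union> Z \<Longrightarrow> fst u i = \<beta> i" "\<And>i. i \<in> A' \<union> Z' \<Longrightarrow> fst u i = \<beta>' i"
      using v by (auto simp: q_eq left_def)
    have r: "\<And>i. i \<in> A \<Longrightarrow> \<beta> i \<in> snd v i" "\<And>i. i \<in> Z \<Longrightarrow> \<beta> i \<notin> snd v i"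
      "\<And>i. i \<in> A' \<Longrightarrow> \<beta>' i \<in> snd v i" "\<And>i. i \<in> Z' \<Longrightarrow> \<beta>' i \<notin> snd v i"
      using v by (auto simp: q_eq right_def)
    \<comment> \<open>At a conflicting coordinate the pointer of \<open>u\<close> would lie both
      inside and outside the same set of \<open>v\<close>.\<close>
    have "(A, Z) = (A', Z')"
    proof (rule ccontr)
      assume "(A, Z) \<noteq> (A', Z')"
      then obtain i where "i \<in> A \<and> i \<in> Z' \<or> i \<in> A' \<and> i \<in> Z" using conflict[OF mem(1,2)] by blast
      then show False using l r by (metis UnCI)
    qed
    moreover from this have "\<beta> = \<beta>'"
    proof (intro PiE_ext[OF mem(3), of \<beta>'])
      show "\<beta>' \<in> PiE (A \<union> Z) (\<lambda>_. {..<m})" using mem(4) \<open>(A, Z) = (A', Z')\<close> by simp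
      show "\<beta> i = \<beta>' i" if "i \<in> A \<union> Z" for i
        using l(1)[OF that] l(2)[of i] that \<open>(A, Z) = (A', Z')\<close> by simp
    qed
    ultimately show ?thesis by (simp add: q_eq)
  qed
  have "\<exists>(W :: (('i \<Rightarrow> nat) \<times> ('i \<Rightarrow> nat set)) set) (K :: (nat \<times> nat) set) A' B'. W \<noteq> {} \<and> K \<noteq> {} \<and> card K \<le> k * k \<and>
    biclique_system W K A' B' \<and> needs_colours W (system_arcs K A' B') (s ^ e)"
  proof (rule biclique_system_of_directed_cover[OF V _ \<open>k > 0\<close>, of "s ^ e" "left \<circ> h" "right \<circ> h"])
    show "0 < s ^ e" using s by simp
    show "i = j" if "i < k" "j < k" "u \<in> (left \<circ> h) i" "v \<in> (right \<circ> h) i" "u \<in> (left \<circ> h) j" "v \<in> (right \<circ> h) j" for u v i j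
      using eq_if_both[OF hQ[OF that(1)] hQ[OF that(2)], of u v] that h_inj by simp
    show "u \<notin> (right \<circ> h) i" if u: "u \<in> V" "i < k" "u \<in> (left \<circ> h) i" for u i
    proof
      assume r: "u \<in> (right \<circ> h) i"
      obtain A Z \<beta> where q: "h i = ((A, Z), \<beta>)" by (metis prod.exhaust)
      then have AZ: "(A, Z) \<in> U" using hQ[OF u(2)] by (simp add: Q_def)
      \<comment> \<open>A hard input pairs each pointer with a set that avoids it, so the one
        demanded at \<open>a\<close> cannot occur.\<close>
      then obtain a where a: "a \<in> A" "a \<in> J" using cert[OF AZ] by blast
      then have "fst u a \<in> snd u a"
        using u r by (simp add: q left_def right_def)
      moreover have "snd u a \<subseteq> {..<m} - {fst u a}"
        using u(1) a(2) by (cases u) (auto simp: V_def hard_inputs_def PiE_iff)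
      ultimately show False by blast
    qed
    fix I assume I: "I \<subseteq> V"
      and ind: "\<And>u v i. u \<in> I \<Longrightarrow> v \<in> I \<Longrightarrow> i < k \<Longrightarrow> u \<in> (left \<circ> h) i \<Longrightarrow> v \<notin> (right \<circ> h) i"
    have "card I * s ^ (2 * e) \<le> card (hard_inputs J (s\<^sup>2))"
    proof (rule independent_hard_inputs[OF J s _ _ _ num, of _ U])
      show "2 * e \<le> n" using D by (simp add: e_def)
      show "A \<subseteq> J \<and> Z \<subseteq> J \<and> A \<inter> Z = {}" if "(A, Z) \<in> U" for A Z
        using cert[OF that] by simp
      show "\<exists>A Z. (A, Z) \<in> U \<and> A \<inter> S = {}" if "S \<subseteq> J" "card S \<le> 2 * e" for S
        using avoid[of S] that by (simp add: e_def)
      show "I \<subseteq> hard_inputs J (s\<^sup>2)" using I by (simp add: V_def m_def)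
      fix x Y x' Y' A Z
      assume xY: "(x, Y) \<in> I" "(x', Y') \<in> I" and AZ: "(A, Z) \<in> U"
        and sat: "\<forall>i\<in>A. x i \<in> Y' i" "\<forall>i\<in>Z. x i \<notin> Y' i"
      define \<beta> where "\<beta> = restrict x (A \<union> Z)"
      have "x \<in> PiE J (\<lambda>_. {..<m})" using xY(1) I by (auto simp: V_def hard_inputs_def)
      then have "\<beta> \<in> PiE (A \<union> Z) (\<lambda>_. {..<m})"
        using cert(1,2)[OF AZ] unfolding \<beta>_def restrict_PiE_iff by (blast dest: PiE_mem)
      then have "((A, Z), \<beta>) \<in> Q" using AZ by (simp add: Q_def)
      then obtain i where i: "i < k" "h i = ((A, Z), \<beta>)" using h_onto by blast
      have "(x, Y) \<in> left (h i)" "(x', Y') \<in> right (h i)"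
        using xY I sat by (auto simp: i left_def right_def \<beta>_def)
      then show False using ind[OF xY i(1)] by simp
    qed
    then show "card I * (s ^ e * s ^ e) \<le> card V"
      by (simp add: V_def m_def mult_2 flip: power_add)
  qed
  then obtain W :: "(('i \<Rightarrow> nat) \<times> ('i \<Rightarrow> nat set)) set" and K :: "(nat \<times> nat) set" and A' B'
    where W: "W \<noteq> {}" "K \<noteq> {}" "card K \<le> k * k" "biclique_system W K A' B'"
      "needs_colours W (system_arcs K A' B') (s ^ e)"
    by (elim exE conjE)
  obtain W2 :: "((('i \<Rightarrow> nat) \<times> ('i \<Rightarrow> nat set)) + (nat \<times> nat) \<times> (('i \<Rightarrow> nat) \<times> ('i \<Rightarrow> nat set)) \<times> nat) set"
    and K2 :: "((nat \<times> nat) \<times> bool + nat) set" and A2 B2 d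
    where W2: "biclique_system W2 K2 A2 B2" "card K2 = 2 * card K + 3"
      "\<forall>v\<in>W2. card (neighbours (system_arcs K2 A2 B2) v) = d"
      "needs_colours W2 (system_arcs K2 A2 B2) (s ^ e)"
    using regular_biclique_system[OF W(4,1,2,5)] by (elim exE conjE)
  obtain G :: "nat pair_pre_digraph" where G: "pair_graph G" "regular_graph G" "bp G \<le> card K2"
      "s ^ e \<le> chromatic_number G"
    using pair_graph_of_biclique_system[OF W2(1) _ W2(4)] W2(3) by blast
  have "card K \<le> (card U * s ^ (2 * r))\<^sup>2"
    using W(3) mult_le_mono[OF cardQ cardQ] by (simp add: k_def power2_eq_square)
  then have "bp G \<le> 2 * (card U * s ^ (2 * r))\<^sup>2 + 3" using G(3) W2(2) by linarith
  then show ?thesis using G unfolding e_def by blast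
qed

section \<open>Choice of parameters\<close>

text \<open>The counting factors amount to 2 to a multiple of \<open>n\<^sup>2\<close>, whereas
  \<open>s = n ^ 5\<close> turns the Hoeffding exponent into \<open>n ^ 3 / 32\<close>.\<close>

lemma gadget_size_condition:
  fixes n :: nat
  assumes n: "n \<ge> 700"
  shows "2 ^ n * real (n ^ 5) ^ n * n * ((real (2 * (n ^ 5)\<^sup>2) ^ n + 1) * exp (- (real (n ^ 5) / (32 * (real n)\<^sup>2)))) < 1"
proof -
  have n2: "real n \<le> 2 ^ n"
    using of_nat_less_two_power[of n, where 'a = real] by simp
  have s: "real (n ^ 5) \<le> 2 ^ (5 * n)"
    using power_mono[OF n2, of 5] by (simp add: mult.commute flip: power_mult)
  have s2: "real (2 * (n ^ 5)\<^sup>2) \<le> 2 ^ (10 * n + 1)"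
    using power_mono[OF s, of 2] by (simp add: mult.commute flip: power_mult)
  define E where "E = n + 5 * n * n + n + ((10 * n + 1) * n + 1)"
  have "2 ^ n * real (n ^ 5) ^ n * n * ((real (2 * (n ^ 5)\<^sup>2) ^ n + 1) * exp (- (real (n ^ 5) / (32 * (real n)\<^sup>2))))
    \<le> 2 ^ n * (2 ^ (5 * n)) ^ n * 2 ^ n * (((2 ^ (10 * n + 1)) ^ n + (2 ^ (10 * n + 1)) ^ n) * exp (- real E))"
  proof (intro mult_mono add_mono power_mono n2 s s2)
    show "(1 :: real) \<le> (2 ^ (10 * n + 1)) ^ n" by (intro one_le_power) auto
    have "1 \<le> n * n" "n \<le> n * n" using n by auto
    moreover have "E = 3 * n + 15 * (n * n) + 1" by (simp add: E_def algebra_simps)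
    \<comment> \<open>The size of \<open>n\<close> enters here, through
      \<open>32 * 19 = 608\<close>.\<close>
    ultimately have "32 * E \<le> 32 * (19 * (n * n))" by linarith
    also have "\<dots> \<le> n * (n * n)" using n by simp
    finally have "real (32 * E) \<le> real (n * (n * n))" by (rule of_nat_mono)
    moreover have "real (n ^ 5) / (32 * (real n)\<^sup>2) = real n ^ 3 / 32"
      using n by (simp add: field_simps flip: power_add)
    ultimately show "exp (- (real (n ^ 5) / (32 * (real n)\<^sup>2))) \<le> exp (- real E)"
      by (simp add: power3_eq_cube)
  qed auto
  also have "\<dots> = 2 ^ E * exp (- real E)"
  proof -
    have "(2 :: real) ^ n * 2 ^ i * 2 ^ n * ((2 ^ j + 2 ^ j) * x) = 2 ^ (n + i + n + (j + 1)) * x" for i j x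
      by (simp add: power_add)
    then show ?thesis unfolding E_def by (simp only: power_mult[symmetric])
  qed
  also have "\<dots> = (2 * exp (- 1)) ^ E"
    by (simp add: power_mult_distrib flip: exp_of_nat_mult)
  also have "\<dots> < 1"
    using two_exp_minus_one_less by (subst power_less_one_iff) (auto simp: E_def)
  finally show ?thesis .
qed

text \<open>Certificates have length of order \<open>p * l ^ 3\<close> and pointers have length of
  order \<open>l\<close>; the product gives \<open>p * l ^ 4\<close>.\<close>

lemma regular_graph_for_prime:
  fixes p l :: nat
  assumes "prime p" and p: "p \<le> 2 ^ l" "700 \<le> p"
  shows "\<exists>G :: nat pair_pre_digraph. pair_graph G \<and> regular_graph G \<and>
    bp G \<le> 2 ^ (20010 * p * l ^ 4) \<and> 2 ^ (p\<^sup>2 div 16) \<le> chromatic_number G"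
proof -
  have "l > 0" using p by (cases l) auto
  define P where "P = {..<p} \<times> {..<p}"
  define X :: "(nat \<times> nat + nat \<times> nat) set" where "X = P <+> P"
  define L where "L = 4 * p * l"
  \<comment> \<open>There are \<open>2 ^ c \<ge> p\<^sup>2 > D\<close> cells. The cell length
    \<open>b\<close> follows from counting certificates, with
    \<open>2 * p\<^sup>2 + 1 \<le> 2 ^ (2 * l + 2)\<close>.\<close>
  define c where "c = 2 * l"
  define b where "b = (2 * l + 2) * (2 * L * c)"
  define D where "D = p\<^sup>2 div 8"
  have X: "finite X" "card X = 2 * p\<^sup>2"
    by (simp_all add: X_def P_def card_Plus card_cartesian_product power2_eq_square)
  obtain C0 C1 where hard: "hard_point X L D C0 C1"
    using hard_point_lines[OF assms(1) p(1) \<open>l > 0\<close>] unfolding X_def P_def L_def D_def by blast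
  have p2: "p\<^sup>2 \<le> 2 ^ (2 * l)"
    using power_mono[OF p(1), of 2] by (simp add: mult.commute flip: power_mult)
  have "card (C0 \<union> C1) ^ c \<le> ((card X + 1) ^ (2 * L)) ^ c"
    using card_certificates_le[OF X(1) hard] by (rule power_mono) simp
  also have "\<dots> = (card X + 1) ^ (2 * L * c)" by (simp only: power_mult)
  also have "\<dots> \<le> (2 ^ (2 * l + 2)) ^ (2 * L * c)"
  proof (rule power_mono)
    have "(1::nat) \<le> 2 ^ (2 * l)" by simp
    moreover have "(2::nat) ^ (2 * l + 2) = 4 * 2 ^ (2 * l)" by simp
    ultimately show "card X + 1 \<le> 2 ^ (2 * l + 2)" using p2 X(2) by linarith
  qed simp
  also have "\<dots> = 2 ^ b" by (simp only: b_def power_mult)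
  finally have b: "card (C0 \<union> C1) ^ c \<le> 2 ^ b" .
  have "0 < p\<^sup>2" using p by simp
  then have "D < p\<^sup>2" unfolding D_def by simp
  then have "D < 2 ^ c" using p2 by (simp add: c_def)
  define J where "J = ({..<c} \<times> X) <+> (Pow {..<c} \<times> {..<b})"
  define r where "r = 2 * c * L + b"
  have "c > 0" using \<open>l > 0\<close> by (simp add: c_def)
  obtain U where U: "certificate_family J r D U" "finite U" "card U \<le> 2 ^ c * 2 ^ b"
    using cheat_sheet[OF X(1) hard \<open>c > 0\<close> \<open>D < 2 ^ c\<close> b] unfolding J_def r_def by blast
  define n where "n = card J"
  have "finite J" using X by (simp add: J_def)
  have n_eq: "n = c * (2 * p\<^sup>2) + 2 ^ c * b"
    using X by (simp add: n_def J_def card_Plus card_cartesian_product card_Pow)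
  have "1 * (2 * p\<^sup>2) \<le> c * (2 * p\<^sup>2)" using \<open>c > 0\<close> by (intro mult_le_mono1) simp
  then have "p\<^sup>2 \<le> n" unfolding n_eq by linarith
  moreover have "p \<le> p\<^sup>2" by (simp add: power2_eq_square)
  ultimately have "700 \<le> n" "D \<le> n" using p(2) \<open>D < p\<^sup>2\<close> by linarith+
  have "n ^ 1 \<le> n ^ 5" using \<open>700 \<le> n\<close> by (intro power_increasing) auto
  then have "2 \<le> n ^ 5" using \<open>700 \<le> n\<close> by simp
  obtain G :: "nat pair_pre_digraph" where G: "pair_graph G" "regular_graph G"
    "bp G \<le> 2 * (card U * (n ^ 5) ^ (2 * r))\<^sup>2 + 3" "(n ^ 5) ^ (D div 2) \<le> chromatic_number G"
    using regular_graph_of_certificate_family[OF U(1,2) \<open>finite J\<close> n_def[symmetric] _ \<open>2 \<le> n ^ 5\<close> \<open>D \<le> n\<close>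
        gadget_size_condition[OF \<open>700 \<le> n\<close>]] \<open>700 \<le> n\<close> by auto
  have "2 ^ (p\<^sup>2 div 16) = (2 :: nat) ^ (D div 2)"
    by (simp add: D_def flip: div_mult2_eq)
  also have "\<dots> \<le> (n ^ 5) ^ (D div 2)"
    using \<open>2 \<le> n ^ 5\<close> by (rule power_mono) simp
  finally have chi: "2 ^ (p\<^sup>2 div 16) \<le> chromatic_number G" using G(4) by linarith
  have l2: "l \<le> 2 ^ l" "l + 1 \<le> 2 ^ l"
    using less_exp[of l] by (simp_all add: Suc_le_eq)
  have n_le: "n \<le> 2 ^ (12 * l)"
  proof -
    have "c * (2 * p\<^sup>2) = 4 * (l * p\<^sup>2)" by (simp add: c_def)
    also have "\<dots> \<le> 4 * (2 ^ l * 2 ^ (2 * l))" by (intro mult_le_mono order_refl l2 p2)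
    also have "\<dots> = 2 ^ (3 * l + 2)" by (simp flip: power_add)
    also have "\<dots> \<le> 2 ^ (6 * l + 5)" by (intro power_increasing) auto
    finally have 1: "c * (2 * p\<^sup>2) \<le> 2 ^ (6 * l + 5)" .
    have "2 ^ c * b = 32 * (2 ^ (2 * l) * (p * (l * (l * (l + 1)))))"
      by (simp add: c_def b_def L_def algebra_simps)
    also have "\<dots> \<le> 32 * (2 ^ (2 * l) * (2 ^ l * (2 ^ l * (2 ^ l * 2 ^ l))))"
      by (intro mult_le_mono order_refl l2 p(1))
    also have "\<dots> = 32 * 2 ^ (6 * l)" by (simp flip: power_add)
    also have "\<dots> = 2 ^ (6 * l + 5)" by (simp add: power_add)
    finally have "n \<le> 2 ^ (6 * l + 5) + 2 ^ (6 * l + 5)" using 1 unfolding n_eq by linarith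
    also have "\<dots> = 2 ^ (6 * l + 6)" by (simp add: power_add)
    also have "\<dots> \<le> 2 ^ (12 * l)" using \<open>l > 0\<close> by (intro power_increasing) auto
    finally show ?thesis .
  qed
  define E where "E = c + b + 12 * l * (5 * (2 * r))"
  have "card U * (n ^ 5) ^ (2 * r) \<le> (2 ^ c * 2 ^ b) * (2 ^ (12 * l)) ^ (5 * (2 * r))"
    unfolding power_mult[symmetric, of n] by (intro mult_le_mono U(3) power_mono n_le) simp
  also have "\<dots> = 2 ^ E" by (simp only: E_def power_add power_mult)
  finally have "(card U * (n ^ 5) ^ (2 * r))\<^sup>2 \<le> (2 ^ E)\<^sup>2" by (rule power_mono) simp
  then have "bp G \<le> 2 * (2 ^ E)\<^sup>2 + 3" using G(3) by linarith
  also have "\<dots> \<le> 2 * (2 ^ E)\<^sup>2 + 6 * (2 ^ E)\<^sup>2"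
  proof -
    have "(1 :: nat) \<le> (2 ^ E)\<^sup>2" by simp
    then show ?thesis by linarith
  qed
  also have "\<dots> = 2 ^ (2 * E + 3)" by (simp add: power_add mult.commute flip: power_mult)
  also have "\<dots> \<le> 2 ^ (20010 * p * l ^ 4)"
  proof (rule power_increasing)
    \<comment> \<open>\<open>E \<le> (2 + 64 + 120 * 80) * q\<close> gives
      \<open>2 * E + 3 \<le> 19335 * q\<close>, rounded up to 20010.\<close>
    define q where "q = p * l ^ 4"
    have le: "p * l ^ 2 \<le> p * l ^ 3" "p * l ^ 3 \<le> q" "l \<le> l ^ 4" "1 \<le> q"
      using \<open>l > 0\<close> p power_increasing[of 1 4 l] by (auto simp: q_def intro!: power_increasing)
    then have "l \<le> q" using p by (auto simp: q_def intro: order_trans[of l "l ^ 4"])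
    have b_le: "b \<le> 64 * (p * l ^ 3)"
      using \<open>l > 0\<close> by (simp add: b_def L_def c_def power3_eq_cube algebra_simps)
    have r_eq: "r = 16 * (p * l ^ 2) + b"
      by (simp add: r_def L_def c_def power2_eq_square)
    have "l * r \<le> l * (80 * (p * l ^ 3))"
      using le(1) b_le unfolding r_eq by (intro mult_le_mono2) linarith
    also have "\<dots> = 80 * q" using power_Suc[of l 3] by (simp add: q_def)
    finally have lr: "l * r \<le> 80 * q" .
    have "2 * E + 3 \<le> 20010 * q"
    proof -
      have "E = 2 * l + b + 120 * (l * r)" by (simp add: E_def c_def)
      then show ?thesis using lr b_le le(2,4) \<open>l \<le> q\<close> by linarith
    qed
    then show "2 * E + 3 \<le> 20010 * p * l ^ 4" by (simp add: q_def)
  qed simp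
  finally show ?thesis using G(1,2) chi by blast
qed

theorem theorem1p2:
  shows "\<exists>a b :: real. a > 0 \<and> b \<ge> 0 \<and>
    infinite {k :: nat. k \<ge> 4 \<and>
      (\<exists>G :: nat pair_pre_digraph.
         pair_graph G \<and> regular_graph G \<and> bp G = k \<and>
         real (chromatic_number G)
           \<ge> real k powr (a * log 2 (real k) / (log 2 (log 2 (real k))) powr b))}"
proof -
  \<comment> \<open>The 16 is the fourth power of the 2 in \<open>l \<le> 2 * y\<close>. The 32 in
    \<open>a\<close> stems from \<open>p\<^sup>2 / 32 \<le> p\<^sup>2 div 16\<close>, and the
    exponent 8 below from squaring \<open>y ^ 4\<close>.\<close>
  define C :: real where "C = 16 * 20010"
  define a where "a = 1 / (32 * C\<^sup>2)"
  let ?good = "\<lambda>k :: nat. k \<ge> 4 \<and>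
      (\<exists>G :: nat pair_pre_digraph.
         pair_graph G \<and> regular_graph G \<and> bp G = k \<and>
         real (chromatic_number G)
           \<ge> real k powr (a * log 2 (real k) / (log 2 (log 2 (real k))) powr 8))"
  have "\<exists>k\<ge>m. ?good k" for m :: nat
  proof -
    obtain p where p: "prime p" "p > m + 700" using bigger_prime by blast
    define l where "l = (LEAST l. p \<le> 2 ^ l)"
    have "p \<le> 2 ^ p" using less_exp[of p] by simp
    then have pl: "p \<le> 2 ^ l" unfolding l_def by (rule LeastI)
    then have "l > 0" using p by (cases l) auto
    then have "\<not> p \<le> 2 ^ (l - 1)" unfolding l_def by (intro not_less_Least) simp
    then have "2 ^ (l - 1) \<le> p" by simp
    then have "real (2 ^ (l - 1)) \<le> real p" by (rule of_nat_mono)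
    then have "2 powr (real l - 1) \<le> real p"
      using \<open>l > 0\<close> by (simp add: of_nat_diff flip: powr_realpow)
    then have "real l - 1 \<le> log 2 (real p)"
      using p by (simp add: le_log_iff)
    define y where "y = log 2 (real p)"
    have "y \<ge> 1" using p by (simp add: y_def)
    then have ly: "real l \<le> 2 * y" using \<open>real l - 1 \<le> log 2 (real p)\<close> by (simp add: y_def)
    obtain G :: "nat pair_pre_digraph" where G: "pair_graph G" "regular_graph G"
      "bp G \<le> 2 ^ (20010 * p * l ^ 4)" "2 ^ (p\<^sup>2 div 16) \<le> chromatic_number G"
      using regular_graph_for_prime[OF p(1) pl] p(2) by auto
    define k where "k = bp G"
    have "16 * p \<le> p\<^sup>2" using p(2) by (simp add: power2_eq_square)
    then have "p \<le> p\<^sup>2 div 16" by simp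
    have "(2 :: nat) ^ (p\<^sup>2 div 16) \<le> 2 ^ k"
      using G(4) chromatic_number_le_two_power_bp[OF G(1)] unfolding k_def by linarith
    then have "p\<^sup>2 div 16 \<le> k" by simp
    then have k: "m \<le> k" "4 \<le> k" using \<open>p \<le> p\<^sup>2 div 16\<close> p(2) by linarith+
    define \<Lambda> where "\<Lambda> = log 2 (real k)"
    have "2 \<le> \<Lambda>" using k(2) by (simp add: \<Lambda>_def le_log_iff)
    then have "1 \<le> log 2 \<Lambda>" by (simp add: le_log_iff)
    define w where "w = log 2 \<Lambda> powr 8"
    have "w \<ge> 1" using \<open>1 \<le> log 2 \<Lambda>\<close> unfolding w_def by (intro ge_one_powr_ge_zero) auto
    have "real k \<le> 2 ^ (20010 * p * l ^ 4)"
      using of_nat_mono[OF G(3), where 'a = real] by (simp add: k_def)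
    then have "\<Lambda> \<le> real (20010 * p * l ^ 4)"
      unfolding \<Lambda>_def using k(2) by (simp add: log_le_iff powr_realpow flip: of_nat_mult of_nat_power)
    also have "\<dots> = 20010 * real p * real l ^ 4" by simp
    also have "\<dots> \<le> 20010 * real p * (2 * y) ^ 4"
      using ly by (intro mult_left_mono power_mono) auto
    also have "\<dots> = C * real p * y ^ 4" by (simp add: C_def power_mult_distrib)
    finally have \<Lambda>_le: "\<Lambda> \<le> C * real p * y ^ 4" .
    have "\<Lambda>\<^sup>2 \<le> (C\<^sup>2 * (real p)\<^sup>2) * w"
    \<comment> \<open>Without a matching lower bound on \<open>k\<close>,
      \<open>log 2 \<Lambda>\<close> may be far below \<open>y\<close>; but then
      \<open>\<Lambda> \<le> p\<close> and \<open>w \<ge> 1\<close> suffices. Otherwise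
      \<open>w\<close> absorbs \<open>y ^ 8\<close>.\<close>
    proof (cases "\<Lambda> \<le> real p")
      case True
      then have "\<Lambda>\<^sup>2 \<le> (real p)\<^sup>2" using \<open>2 \<le> \<Lambda>\<close> by (intro power_mono) auto
      also have "\<dots> = 1 * (real p)\<^sup>2 * 1" by simp
      also have "\<dots> \<le> C\<^sup>2 * (real p)\<^sup>2 * w"
        using \<open>w \<ge> 1\<close> by (intro mult_mono) (auto simp: C_def)
      finally show ?thesis .
    next
      case False
      then have "y \<le> log 2 \<Lambda>" unfolding y_def using p by simp
      then have "y powr 8 \<le> w" unfolding w_def using \<open>y \<ge> 1\<close> by (intro powr_mono2) auto
      then have "y ^ 8 \<le> w" using \<open>y \<ge> 1\<close> by (simp add: powr_numeral)
      have "\<Lambda>\<^sup>2 \<le> (C * real p * y ^ 4)\<^sup>2" using \<Lambda>_le \<open>2 \<le> \<Lambda>\<close> by (intro power_mono) auto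
      also have "\<dots> = C\<^sup>2 * (real p)\<^sup>2 * y ^ 8" by (simp add: power_mult_distrib flip: power_mult)
      also have "\<dots> \<le> C\<^sup>2 * (real p)\<^sup>2 * w" using \<open>y ^ 8 \<le> w\<close> by (intro mult_left_mono) auto
      finally show ?thesis .
    qed
    then have "a * \<Lambda>\<^sup>2 / w \<le> a * (C\<^sup>2 * (real p)\<^sup>2 * w) / w"
      using \<open>w \<ge> 1\<close> by (intro divide_right_mono mult_left_mono) (auto simp: a_def)
    also have "\<dots> = (real p)\<^sup>2 / 32" using \<open>w \<ge> 1\<close> by (simp add: a_def C_def)
    also have "\<dots> \<le> real (p\<^sup>2 div 16)"
    proof -
      have "p\<^sup>2 \<le> 32 * (p\<^sup>2 div 16)" using \<open>p \<le> p\<^sup>2 div 16\<close> p(2) by linarith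
      then have "real (p\<^sup>2) \<le> real (32 * (p\<^sup>2 div 16))" by (rule of_nat_mono)
      then show ?thesis by simp
    qed
    finally have exponent: "a * \<Lambda>\<^sup>2 / w \<le> real (p\<^sup>2 div 16)" .
    have "real k powr (a * \<Lambda> / w) = (2 powr \<Lambda>) powr (a * \<Lambda> / w)"
      using k(2) by (simp add: \<Lambda>_def)
    also have "\<dots> = 2 powr (a * \<Lambda>\<^sup>2 / w)"
      by (simp add: powr_powr power2_eq_square ac_simps)
    also have "\<dots> \<le> 2 powr (real (p\<^sup>2 div 16))" using exponent by simp
    also have "\<dots> = real (2 ^ (p\<^sup>2 div 16))" by (simp add: powr_realpow)
    also have "\<dots> \<le> real (chromatic_number G)" using G(4) by (rule of_nat_mono)
    finally have "real (chromatic_number G) \<ge> real k powr (a * log 2 (real k) / log 2 (log 2 (real k)) powr 8)"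
      by (simp add: \<Lambda>_def w_def)
    then show ?thesis
      using k G(1,2) k_def by (intro exI[of _ k]) blast
  qed
  then have "infinite {k. ?good k}"
    unfolding infinite_nat_iff_unbounded_le by simp
  moreover have "a > 0" by (simp add: a_def C_def)
  ultimately show ?thesis
    by - (rule exI[of _ a], rule exI[of _ 8], intro conjI; simp)
qed

end
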